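(* If $d\in\Delta^\times$ has level $n=p^r+m-1$ of type $0$ (so $m\ge1$ and $m\not\equiv0\bmod p$), then $d\equiv[u,1-\Pi^mx]\bmod\Pi^{n+1}\Delta$ for some $x\in\Delta$.
   Context: Let $p$ be an odd prime, $r\ge1$, $s\ge1$ integers, $F/\mathbb Q_p$ a finite unramified extension with ring of integers $\mathfrak O$. Fix primitive $p^m$-th roots of unity $\zeta_m$ with $\zeta_0=1$, $\zeta_m^p=\zeta_{m-1}$; put $\mathfrak O_m=\mathfrak O[\zeta_m]$, $\pi_m=1-\zeta_m$, $\Pi=\pi_{r+s}$, $\pi=\pi_r$, $A=\mathfrak O_r[[T]]$, $B=\mathfrak O_{r+s}[[T]]$, with fraction fields $\mathfrak q(A),\mathfrak q(B)$. Let $g$ be the generator of the cyclic group $\mathrm{Gal}(\mathfrak q(B)/\mathfrak q(A))$ (of order $p^s$) fixing $\mathfrak q(A)$ with $\zeta_{r+s}\mapsto\zeta_{r+s}^{1+p^r}$. $D=\bigoplus_{j=0}^{p^s-1}\mathfrak q(B)u^j$ with $ub={}^gb\,u$ and $u^{p^s}=1+T$ is a division algebra with centre $\mathfrak q(A)$, and $\Delta=\bigoplus_{j=0}^{p^s-1}Bu^j$ is an $A$-order in $D$ with $\Pi\Delta=\Delta\Pi$. The level of $d\in1+\Pi\Delta$ is $\max\{k\ge1:d\in1+\Pi^k\Delta\}$ (having level $n$ includes $d\in 1+\Pi\Delta$). The integer $n\ge1$ has type $t\ge0$ if $n=p^{r+t}+p^tm-1$ for some $m\ge1$ with $m\not\equiv0\bmod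 p$. $[x,y]=xyx^{-1}y^{-1}$; elements of $1+\Pi\Delta$ are units of $\Delta$. *)

theory Defs
  imports
    "HOL-Algebra.Algebra"
    "HOL-Algebra.Algebraic_Closure_Type"
    "HOL-Computational_Algebra.Computational_Algebra"
begin

text \<open>
  All fields are subsets of an arbitrary ambient field \<open>'a\<close> containing \<open>F\<close> and the roots of unity.
  The power series ring over a subring of \<open>'a\<close> is a subset of \<^typ>\<open>'a fps\<close>, and its fraction field a
  subset of the field \<^typ>\<open>'a fps fract\<close>.
\<close>

text \<open>The inverse limit of the rings of integers modulo \<open>p ^ k\<close>, by least residues.\<close>

definition padic_ints :: "nat \<Rightarrow> (nat \<Rightarrow> int) ring" where
  "padic_ints p =
    \<lparr>carrier = {a. \<forall>k. a k \<in> {0..<int p ^ k} \<and> a (Suc k) mod int p ^ k = a k},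
     monoid.mult = (\<lambda>a b k. (a k * b k) mod int p ^ k),
     monoid.one = (\<lambda>k. 1 mod int p ^ k),
     ring.zero = (\<lambda>k. 0),
     ring.add = (\<lambda>a b k. (a k + b k) mod int p ^ k)\<rparr>"

definition ring_on :: "'a :: ring_1 set \<Rightarrow> 'a ring" where
  "ring_on S = ring_of_type_algebra\<lparr>carrier := S\<rparr>"

definition quotients :: "'a :: field set \<Rightarrow> 'a set" where
  "quotients R = {x / y | x y. x \<in> R \<and> y \<in> R \<and> y \<noteq> 0}"

definition integral_closure :: "'a :: field set \<Rightarrow> 'a set \<Rightarrow> 'a set" where
  "integral_closure R F =
    {x \<in> F. \<exists>f. Polynomial.lead_coeff f = 1 \<and> (\<forall>i. Polynomial.coeff f i \<in> R) \<and> poly f x = 0}"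

definition ring_of_integers :: "nat \<Rightarrow> ((nat \<Rightarrow> int) \<Rightarrow> 'a :: field) \<Rightarrow> 'a set \<Rightarrow> 'a set" where
  "ring_of_integers p \<iota> F = integral_closure (\<iota> ` carrier (padic_ints p)) F"

text \<open>
  The map \<open>\<iota>\<close> embeds the \<open>p\<close>-adic integers into \<open>'a\<close>, and hence the \<open>p\<close>-adic numbers as the quotients of
  its image. The ring of integers of a finite extension is a discrete valuation ring with finite
  residue field, so being unramified means that \<open>p\<close> generates its maximal ideal.
\<close>

definition finite_unramified_extension ::
  "nat \<Rightarrow> ((nat \<Rightarrow> int) \<Rightarrow> 'a :: field) \<Rightarrow> 'a set \<Rightarrow> bool" where
  "finite_unramified_extension p \<iota> F \<longleftrightarrow>
    \<iota> \<in> ring_hom (padic_ints p) ring_of_type_algebra \<and>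
    inj_on \<iota> (carrier (padic_ints p)) \<and>
    subfield F ring_of_type_algebra \<and>
    quotients (\<iota> ` carrier (padic_ints p)) \<subseteq> F \<and>
    ring.finite_dimension ring_of_type_algebra (quotients (\<iota> ` carrier (padic_ints p))) F \<and>
    maximalideal (PIdl\<^bsub>ring_on (ring_of_integers p \<iota> F)\<^esub> (of_nat p)) (ring_on (ring_of_integers p \<iota> F))"

definition primitive_root_of_unity :: "nat \<Rightarrow> 'a :: field \<Rightarrow> bool" where
  "primitive_root_of_unity k z \<longleftrightarrow> z ^ k = 1 \<and> (\<forall>j. 0 < j \<and> j < k \<longrightarrow> z ^ j \<noteq> 1)"

definition adjoin :: "'a :: field set \<Rightarrow> 'a \<Rightarrow> 'a set" where
  "adjoin R z = {poly f z | f. \<forall>i. Polynomial.coeff f i \<in> R}"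

definition power_series_over :: "'a :: field set \<Rightarrow> 'a fps set" where
  "power_series_over R = {f. \<forall>i. fps_nth f i \<in> R}"

definition fraction_field :: "'a :: idom set \<Rightarrow> 'a fract set" where
  "fraction_field R = quotients (to_fract ` R)"

definition galois_group :: "'a :: field set \<Rightarrow> 'a set \<Rightarrow> ('a \<Rightarrow> 'a) monoid" where
  "galois_group K k = BijGroup K
    \<lparr>carrier := {\<sigma> \<in> Bij K. \<sigma> \<in> ring_hom (ring_on K) (ring_on K) \<and> (\<forall>x\<in>k. \<sigma> x = x)}\<rparr>"

text \<open>
  The cyclic algebra \<open>K \<oplus> K u \<oplus> \<dots> \<oplus> K u ^ (N - 1)\<close> with \<open>u b = g b u\<close> and \<open>u ^ N = c\<close>: an element is
  its family of coefficients, supported on \<open>{..<N}\<close>, so that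
  \<open>(a u ^ i) (b u ^ j) = a (g ^ i) b u ^ (i + j)\<close> contributes to the coefficient at \<open>i + j\<close>, or,
  multiplied by \<open>c\<close>, to that at \<open>i + j - N\<close>.
\<close>

definition cyclic_algebra ::
  "'a :: field set \<Rightarrow> ('a \<Rightarrow> 'a) \<Rightarrow> nat \<Rightarrow> 'a \<Rightarrow> (nat \<Rightarrow> 'a) ring" where
  "cyclic_algebra K g N c =
    \<lparr>carrier = {a. (\<forall>j<N. a j \<in> K) \<and> (\<forall>j\<ge>N. a j = 0)},
     monoid.mult = (\<lambda>a b k. if k < N then
        (\<Sum>i<N. \<Sum>j<N. if i + j = k then a i * (g ^^ i) (b j)
                       else if i + j = k + N then a i * (g ^^ i) (b j) * c
                       else 0) else 0),
     monoid.one = (\<lambda>k. if k = 0 then 1 else 0),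
     ring.zero = (\<lambda>k. 0),
     ring.add = (\<lambda>a b k. a k + b k)\<rparr>"

definition single_term :: "'a :: zero \<Rightarrow> nat \<Rightarrow> nat \<Rightarrow> 'a" where
  "single_term b j = (\<lambda>k. if k = j then b else 0)"

definition one_plus :: "'b ring \<Rightarrow> 'b \<Rightarrow> nat \<Rightarrow> 'b set" where
  "one_plus R P k = \<one>\<^bsub>R\<^esub> <+\<^bsub>R\<^esub> ((P [^]\<^bsub>R\<^esub> k) <#\<^bsub>R\<^esub> carrier R)"

definition has_level :: "'b ring \<Rightarrow> 'b \<Rightarrow> 'b \<Rightarrow> nat \<Rightarrow> bool" where
  "has_level R P d n \<longleftrightarrow> 1 \<le> n \<and> d \<in> one_plus R P n \<and> (\<forall>k\<ge>1. d \<in> one_plus R P k \<longrightarrow> k \<le> n)"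

definition has_type :: "nat \<Rightarrow> nat \<Rightarrow> nat \<Rightarrow> nat \<Rightarrow> bool" where
  "has_type p r n t \<longleftrightarrow> 1 \<le> n \<and> (\<exists>m\<ge>1. \<not> p dvd m \<and> n = p ^ (r + t) + p ^ t * m - 1)"

definition commutator :: "('b, 'c) monoid_scheme \<Rightarrow> 'b \<Rightarrow> 'b \<Rightarrow> 'b" where
  "commutator G x y = x \<otimes>\<^bsub>G\<^esub> y \<otimes>\<^bsub>G\<^esub> inv\<^bsub>G\<^esub> x \<otimes>\<^bsub>G\<^esub> inv\<^bsub>G\<^esub> y"

end

theory Submission
  imports Defs
begin

text \<open>
  Write \<open>d = 1 + \<Pi>\<^sup>n y\<close>. An \<open>x\<close> with coefficients in \<open>\<OO>[[T]]\<close> commutes with \<open>u\<close>, so that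
  \<open>u (1 - \<Pi>\<^sup>m x) u\<^sup>-\<^sup>1 = 1 - g(\<Pi>)\<^sup>m x\<close>. Since \<open>1 - \<zeta>\<^bsub>r+s\<^esub>\<close> raised to the power \<open>p\<^sup>r\<close> is
  \<open>1 - \<zeta>\<^sub>s\<close> up to higher order, \<open>g(\<Pi>)\<^sup>m = \<Pi>\<^sup>m + \<Pi>\<^sup>n (m + \<Pi> e)\<close>, and the commutator is congruent to
  \<open>1 - m \<Pi>\<^sup>n x\<close> modulo \<open>\<Pi>\<^bsup>n+1\<^esup>\<close>. It remains to solve \<open>m x = - y\<close> modulo \<open>\<Pi>\<close>, which is possible
  because \<open>m\<close> is prime to \<open>p\<close> and \<open>\<OO>\<close> maps onto \<open>\<OO>[\<zeta>\<^bsub>r+s\<^esub>] / \<Pi>\<close>. Completeness is never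
  used: that \<open>1 + \<Pi> \<Delta>\<close> consists of units comes from Nakayama's lemma, starting from \<open>1 + p \<int>\<^sub>p\<close>.
\<close>

section \<open>Subrings and prime-power roots of unity\<close>

text \<open>The decisive estimate is that \<open>\<pi> ^ (p ^ r + 1)\<close> divides p. The binomial
  congruences for powers p^k hold only modulo p, and this error must lie beyond the leading term
  \<open>\<pi> ^ p ^ r\<close> of \<open>1 - z ^ p ^ r\<close>. For odd p even
  \<open>\<pi> ^ (2 * p ^ (h - 1))\<close> divides p, where h = r + s, and this is enough since r <
  h; for p = 2 and s = 1 the two orders would coincide. Invertibility spreads along Z_p, O, O[[T]],
  O_(r+s)[[T]] and \<open>\<Delta>\<close>, with a separate argument for each inclusion: an integral
  equation, the constant coefficient, Nakayama for p over the powers of z, and Nakayama for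
  \<open>\<Pi>\<close> over the powers of u; Frobenius improves 1 + p S to 1 + \<open>\<pi>\<close>
  S. Neither a basis of O over Z_p nor a minimal polynomial of z is chosen: the relation z^(p^h) = 1
  bounds the number of powers. The inverse of w = 1 - \<open>\<Pi>\<close>^m x is never expanded: if
  w' is the conjugate of w by u, then d - w' w^(-1) = (d w - w') w^(-1), and
  \<open>\<Pi>\<close>^(n+1) \<open>\<Delta>\<close> is a right ideal.\<close>

locale unital_subring =
  fixes S :: "'a :: comm_ring_1 set"
  assumes one_closed [simp, intro]: "1 \<in> S"
    and diff_closed [simp, intro]: "a \<in> S \<Longrightarrow> b \<in> S \<Longrightarrow> a - b \<in> S"
    and mult_closed [simp, intro]: "a \<in> S \<Longrightarrow> b \<in> S \<Longrightarrow> a * b \<in> S"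
begin

lemma zero_closed [simp, intro]: "0 \<in> S"
  using diff_closed[OF one_closed one_closed] by simp

lemma uminus_closed [simp, intro]: "a \<in> S \<Longrightarrow> - a \<in> S"
  using diff_closed[OF zero_closed] by fastforce

lemma add_closed [simp, intro]: "a \<in> S \<Longrightarrow> b \<in> S \<Longrightarrow> a + b \<in> S"
  using diff_closed[of a "- b"] by simp

lemma power_closed [simp, intro]: "a \<in> S \<Longrightarrow> a ^ k \<in> S"
  by (induction k) auto

lemma of_nat_closed [simp, intro]: "of_nat k \<in> S"
  by (induction k) auto

lemma of_int_closed [simp, intro]: "of_int k \<in> S"
  by (cases k rule: int_cases) auto

lemma sum_closed [intro]: "(\<And>i. i \<in> I \<Longrightarrow> f i \<in> S) \<Longrightarrow> sum f I \<in> S"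
  by (induction I rule: infinite_finite_induct) auto

lemma power_diff_one_dvd:
  assumes "a \<in> S"
  obtains t where "t \<in> S" "a ^ k = 1 + (a - 1) * t"
proof
  show "(\<Sum>i<k. a ^ i) \<in> S" using assms by blast
  show "a ^ k = 1 + (a - 1) * (\<Sum>i<k. a ^ i)"
    using power_diff_1_eq[of a k] by (simp add: algebra_simps)
qed

lemma power_one_plus_order2:
  assumes "a \<in> S"
  obtains t where "t \<in> S" "(1 + a) ^ k = 1 + of_nat k * a + a ^ 2 * t"
proof -
  have "\<exists>t\<in>S. (1 + a) ^ k = 1 + of_nat k * a + a ^ 2 * t"
  proof (induction k)
    case 0
    show ?case by (rule bexI[of _ 0]) auto
  next
    case (Suc k)
    then obtain t where "t \<in> S" "(1 + a) ^ k = 1 + of_nat k * a + a ^ 2 * t" by blast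
    then show ?case using assms
      by (intro bexI[of _ "of_nat k + t + a * t"])
         (auto simp: algebra_simps power2_eq_square)
  qed
  then show ?thesis using that by blast
qed

lemma freshmans_dream_mod:
  assumes "Factorial_Ring.prime p" "a \<in> S" "b \<in> S"
  obtains t where "t \<in> S" "(a + b) ^ p = a ^ p + b ^ p + of_nat p * t"
proof
  have p0: "p > 0" using assms(1) prime_gt_0_nat by blast
  let ?f = "\<lambda>k. of_nat (p choose k) * a ^ k * b ^ (p - k)"
  let ?t = "\<Sum>k\<in>{1..<p}. of_nat ((p choose k) div p) * a ^ k * b ^ (p - k)"
  show "?t \<in> S" using assms by (intro sum_closed mult_closed) auto
  have "(\<Sum>k\<in>{1..<p}. ?f k) = of_nat p * ?t"
    unfolding sum_distrib_left
  proof (intro sum.cong refl)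
    fix k assume "k \<in> {1..<p}"
    then have "p dvd (p choose k)" using assms(1) by (intro dvd_choose_prime) auto
    then have "p choose k = p * ((p choose k) div p)" by simp
    then have "of_nat (p choose k) = of_nat p * (of_nat ((p choose k) div p) :: 'a)"
      by (metis of_nat_mult)
    then show "?f k = of_nat p * (of_nat ((p choose k) div p) * a ^ k * b ^ (p - k))"
      by (simp add: mult.assoc)
  qed
  moreover have "{..p} = insert 0 (insert p {1..<p})" using p0 by auto
  ultimately show "(a + b) ^ p = a ^ p + b ^ p + of_nat p * ?t"
    using p0 by (simp add: binomial_ring)
qed

lemma freshmans_dream_mod_power:
  assumes "Factorial_Ring.prime p" "a \<in> S" "b \<in> S"
  obtains t where "t \<in> S" "(a + b) ^ p ^ k = a ^ p ^ k + b ^ p ^ k + of_nat p * t"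
proof -
  have p0: "p > 0" using assms(1) prime_gt_0_nat by blast
  have "\<exists>t\<in>S. (a + b) ^ p ^ k = a ^ p ^ k + b ^ p ^ k + of_nat p * t"
  proof (induction k)
    case 0
    show ?case by (rule bexI[of _ 0]) auto
  next
    case (Suc k)
    then obtain t where t: "t \<in> S" "(a + b) ^ p ^ k = a ^ p ^ k + b ^ p ^ k + of_nat p * t" by blast
    obtain t1 where t1: "t1 \<in> S" "(a ^ p ^ k + b ^ p ^ k + of_nat p * t) ^ p
        = (a ^ p ^ k + b ^ p ^ k) ^ p + (of_nat p * t) ^ p + of_nat p * t1"
      using freshmans_dream_mod[OF assms(1), of "a ^ p ^ k + b ^ p ^ k" "of_nat p * t"] assms t
      by blast
    obtain t2 where t2: "t2 \<in> S" "(a ^ p ^ k + b ^ p ^ k) ^ p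
        = (a ^ p ^ k) ^ p + (b ^ p ^ k) ^ p + of_nat p * t2"
      using freshmans_dream_mod[OF assms(1), of "a ^ p ^ k" "b ^ p ^ k"] assms by blast
    have pp: "(x ^ p ^ k) ^ p = x ^ p ^ Suc k" for x :: 'a
      by (simp add: mult.commute flip: power_mult)
    have pt: "(of_nat p * t) ^ p = of_nat p * (t * (of_nat p * t) ^ (p - 1))"
      using power_minus_mult[OF p0, of "of_nat p * t"] by (simp add: mult_ac)
    have "(a + b) ^ p ^ Suc k = (a ^ p ^ k + b ^ p ^ k + of_nat p * t) ^ p"
      by (simp only: pp[symmetric] t(2))
    also have "\<dots> = a ^ p ^ Suc k + b ^ p ^ Suc k + of_nat p * t2
        + of_nat p * (t * (of_nat p * t) ^ (p - 1)) + of_nat p * t1"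
      by (simp only: t1(2) t2(2) pp pt)
    finally have "(a + b) ^ p ^ Suc k
        = a ^ p ^ Suc k + b ^ p ^ Suc k + of_nat p * (t2 + t * (of_nat p * t) ^ (p - 1) + t1)"
      by (simp only: distrib_left add.assoc)
    then show ?case using t t1 t2
      by (intro bexI[of _ "t2 + t * (of_nat p * t) ^ (p - 1) + t1"]) auto
  qed
  then show ?thesis using that by blast
qed

end

text \<open>Writing \<open>x ^ (p ^ i) = 1 + a\<close>, the p-th power is 1 + p a up to a multiple
  of a^2, and p divides a, so each step gains a factor p. With x = 1 + p^r, j = r and i = s this
  bounds the order of g on roots of unity.\<close>

lemma power_prime_power_dvd:
  fixes x :: int
  assumes "int p ^ j dvd x - 1" "1 \<le> j"
  shows "int p ^ (j + i) dvd x ^ (p ^ i) - 1"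
proof (induction i)
  case 0
  then show ?case using assms by simp
next
  case (Suc i)
  interpret unital_subring "UNIV :: int set" by unfold_locales auto
  define a where "a = x ^ (p ^ i) - 1"
  obtain t where t: "(1 + a) ^ p = 1 + of_nat p * a + a ^ 2 * t"
    using power_one_plus_order2[of a p] by blast
  have a: "int p ^ (j + i) dvd a" using Suc by (simp add: a_def)
  moreover have "int p dvd int p ^ (j + i)" using assms(2) by (intro dvd_power) auto
  ultimately have "int p dvd a" using dvd_trans by blast
  then have "int p * int p ^ (j + i) dvd of_nat p * a" "int p * int p ^ (j + i) dvd a ^ 2"
    using a by (auto simp: power2_eq_square intro!: mult_dvd_mono)
  then have "int p * int p ^ (j + i) dvd of_nat p * a + a ^ 2 * t" by simp
  also have "of_nat p * a + a ^ 2 * t = (x ^ (p ^ i)) ^ p - 1" using t by (simp add: a_def)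
  also have "(x ^ (p ^ i)) ^ p = x ^ (p ^ Suc i)" by (simp add: mult.commute flip: power_mult)
  finally show ?case by simp
qed

text \<open>To be applied to \<open>S = \<OO>[\<zeta>\<^bsub>h\<^esub>][[T]]\<close> with \<open>h = r + s\<close>.\<close>

locale cyclotomic_subring = unital_subring S for S :: "'a :: idom set" +
  fixes p h :: nat and z :: 'a
  assumes prime_p: "Factorial_Ring.prime p" and odd_p: "odd p"
    and h_pos: "1 \<le> h"
    and z_closed [simp, intro]: "z \<in> S"
    and z_root: "z ^ p ^ h = 1" and z_primitive: "z ^ p ^ (h - 1) \<noteq> 1"
    and unit_mod_p: "a \<in> S \<Longrightarrow> \<exists>b\<in>S. (1 + of_nat p * a) * b = 1"
begin

abbreviation "\<pi> \<equiv> 1 - z"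

lemma p_ge_3: "3 \<le> p"
  using prime_p odd_p prime_ge_2_nat[of p] by (cases "p = 2") auto

text \<open>Frobenius modulo p, applied to the two summands of \<open>z + \<pi> = 1\<close>.\<close>

lemma one_minus_power_cong:
  obtains t where "t \<in> S" "1 - z ^ p ^ k = \<pi> ^ p ^ k + of_nat p * t"
proof -
  obtain t where "t \<in> S" "(z + \<pi>) ^ p ^ k = z ^ p ^ k + \<pi> ^ p ^ k + of_nat p * t"
    using freshmans_dream_mod_power[OF prime_p, of z \<pi> k] by blast
  then show ?thesis using that[of t] by (simp add: algebra_simps)
qed

text \<open>The power \<open>w ^ p ^ h\<close> of \<open>w = 1 + \<pi> * a\<close> lies in 1 + p S,
  because \<open>\<pi> ^ p ^ h\<close> is congruent to \<open>1 - z ^ p ^ h = 0\<close> modulo p.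
  Thus w divides a unit.\<close>

lemma unit_mod_pi:
  assumes "a \<in> S"
  obtains b where "b \<in> S" "(1 + \<pi> * a) * b = 1"
proof -
  define w where "w = 1 + \<pi> * a"
  have w: "w \<in> S" using assms by (auto simp: w_def)
  obtain t where t: "t \<in> S" "1 - z ^ p ^ h = \<pi> ^ p ^ h + of_nat p * t"
    using one_minus_power_cong .
  obtain t' where t': "t' \<in> S" "(w + \<pi> * (- a)) ^ p ^ h
      = w ^ p ^ h + (\<pi> * (- a)) ^ p ^ h + of_nat p * t'"
    using freshmans_dream_mod_power[OF prime_p w, of "\<pi> * (- a)" h] assms by blast
  have "w + \<pi> * (- a) = 1" by (simp add: w_def)
  then have "1 = w ^ p ^ h + \<pi> ^ p ^ h * (- a) ^ p ^ h + of_nat p * t'"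
    using t'(2) by (simp only: power_one power_mult_distrib)
  then have "w ^ p ^ h = 1 - \<pi> ^ p ^ h * (- a) ^ p ^ h - of_nat p * t'"
    by (simp only: eq_diff_eq add.assoc add.commute)
  also have "\<pi> ^ p ^ h = - (of_nat p * t)"
    using t by (simp add: z_root algebra_simps add_eq_0_iff)
  finally have "w ^ p ^ h = 1 + of_nat p * (t * (- a) ^ p ^ h - t')"
    by (simp add: algebra_simps)
  moreover obtain b where "b \<in> S" "(1 + of_nat p * (t * (- a) ^ p ^ h - t')) * b = 1"
    using unit_mod_p[of "t * (- a) ^ p ^ h - t'"] t t' assms by blast
  moreover have "w ^ p ^ h = w * w ^ (p ^ h - 1)"
    using power_minus_mult[of "p ^ h" w] prime_p by (simp add: mult.commute prime_gt_0_nat)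
  ultimately show ?thesis
    using that[of "w ^ (p ^ h - 1) * b"] w by (auto simp: w_def mult.assoc)
qed

text \<open>
  With \<open>\<lambda> = 1 - \<zeta>\<^sub>1\<close>, expanding \<open>0 = 1 + \<zeta>\<^sub>1 + \<dots> + \<zeta>\<^sub>1\<^bsup>p-1\<^esup>\<close> to second order gives
  \<open>p (1 - \<lambda> (p - 1) / 2) \<in> \<lambda>\<^sup>2 S\<close>, and \<open>\<lambda>\<close> is \<open>\<pi>\<^bsup>p\<^bsup>h-1\<^esup>\<^esup>\<close> up to a unit.
\<close>

lemma pi_power_dvd_p:
  obtains t where "t \<in> S" "of_nat p = \<pi> ^ (2 * p ^ (h - 1)) * t"
proof -
  define y where "y = z ^ p ^ (h - 1)"
  define l where "l = 1 - y"
  define k where "k = (p - 1) div 2"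
  have [simp, intro]: "y \<in> S" "l \<in> S" by (auto simp: y_def l_def)
  \<comment> \<open>As p is odd, 0 + ... + (p - 1) is p times the integer k. The linear term is
    therefore a multiple of p and only the quadratic term remains on the other side.\<close>
  have pk: "p = 2 * k + 1" using odd_p by (auto simp: k_def)
  have "y ^ p = z ^ (p ^ (h - 1) * p)" by (simp add: y_def power_mult)
  also have "p ^ (h - 1) * p = p ^ h" using h_pos by (cases h) auto
  finally have "(y - 1) * (\<Sum>i<p. y ^ i) = 0"
    using power_diff_1_eq[of y p] z_root by simp
  then have sum0: "(\<Sum>i<p. y ^ i) = 0" using z_primitive by (simp add: y_def)
  have "\<exists>t\<in>S. y ^ i = 1 - of_nat i * l + l ^ 2 * t" for i
  proof -
    obtain t where t: "t \<in> S" "(1 + - l) ^ i = 1 + of_nat i * - l + (- l) ^ 2 * t"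
      using power_one_plus_order2[of "- l" i] by blast
    have "1 + - l = y" by (simp add: l_def)
    then show ?thesis using t by (intro bexI[of _ t]) simp_all
  qed
  then obtain t where t: "\<And>i. t i \<in> S" "\<And>i. y ^ i = 1 - of_nat i * l + l ^ 2 * t i"
    by metis
  have "(\<Sum>i<p. i) = p * k"
    using gauss_sum_nat[of "p - 1"] unfolding pk
    by (simp add: lessThan_Suc_atMost atLeast0AtMost flip: lessThan_Suc_atMost)
  then have s: "(\<Sum>i<p. of_nat i :: 'a) = of_nat p * of_nat k"
    by (simp only: of_nat_sum[symmetric] of_nat_mult)
  have "0 = (\<Sum>i<p. 1 - of_nat i * l + l ^ 2 * t i)"
    using sum0 t(2) by simp
  also have "\<dots> = of_nat p - (\<Sum>i<p. of_nat i) * l + l ^ 2 * sum t {..<p}"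
    by (simp add: sum.distrib sum_subtractf sum_distrib_left sum_distrib_right)
  finally have 1: "of_nat p * (1 - l * of_nat k) = - (l ^ 2 * sum t {..<p})"
    by (simp add: s algebra_simps add_eq_0_iff)
  obtain e where e: "e \<in> S" "z ^ p ^ (h - 1) = 1 + (z - 1) * e"
    using power_diff_one_dvd[OF z_closed] by blast
  have le: "l = \<pi> * e" using e by (simp add: l_def y_def algebra_simps)
  obtain b where b: "b \<in> S" "(1 + \<pi> * (- (e * of_nat k))) * b = 1"
    using unit_mod_pi[of "- (e * of_nat k)"] e by blast
  have "of_nat p = of_nat p * ((1 + \<pi> * (- (e * of_nat k))) * b)" using b by simp
  also have "\<dots> = of_nat p * (1 - l * of_nat k) * b" by (simp add: le algebra_simps)
  also have "\<dots> = l ^ 2 * (- sum t {..<p} * b)" by (simp add: 1)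
  finally obtain c where c: "c \<in> S" "of_nat p = l ^ 2 * c"
    using b t by (metis mult_closed sum_closed uminus_closed)
  \<comment> \<open>The error p d equals \<open>l ^ 2 * c * d\<close>, which is l times a multiple
    of \<open>\<pi>\<close>. Moving it to the other side leaves l times a unit.\<close>
  obtain d where d: "d \<in> S" "l = \<pi> ^ p ^ (h - 1) + of_nat p * d"
    using one_minus_power_cong[of "h - 1"] by (auto simp: l_def y_def)
  obtain f where f: "f \<in> S" "(1 + \<pi> * (- (e * c * d))) * f = 1"
    using unit_mod_pi[of "- (e * c * d)"] e c d by blast
  have "l = l * (1 + \<pi> * (- (e * c * d))) * f" using f by (simp add: mult.assoc)
  also have "l * (1 + \<pi> * (- (e * c * d))) = l - of_nat p * d"
    unfolding c(2) by (simp add: algebra_simps power2_eq_square le)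
  also have "\<dots> = \<pi> ^ p ^ (h - 1)" using d by simp
  finally have "of_nat p = \<pi> ^ (2 * p ^ (h - 1)) * (f ^ 2 * c)"
    unfolding c(2) by (simp add: power_mult_distrib power_even_eq mult.assoc flip: power_mult)
  moreover have "f ^ 2 * c \<in> S" using f(1) c(1) by (intro mult_closed power_closed)
  ultimately show ?thesis by (rule that[rotated])
qed

lemma pi_dvd_p:
  assumes "j \<le> 2 * p ^ (h - 1)"
  obtains t where "t \<in> S" "of_nat p = \<pi> ^ j * t"
proof -
  obtain t where t: "t \<in> S" "of_nat p = \<pi> ^ (2 * p ^ (h - 1)) * t"
    using pi_power_dvd_p .
  show ?thesis
    using that[of "\<pi> ^ (2 * p ^ (h - 1) - j) * t"] t assms
    by (auto simp: mult.assoc[symmetric] simp flip: power_add)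
qed

text \<open>The conjugate is \<open>\<pi> + z * (1 - z ^ p ^ r)\<close>, and Frobenius replaces the
  bracket by \<open>\<pi> ^ p ^ r\<close> modulo p. From \<open>r \<le> h - 1\<close> follows
  \<open>p ^ r + 1 \<le> 2 * p ^ (h - 1)\<close>, so p affects only higher order; writing
  \<open>z = 1 - \<pi>\<close> produces the witness
  \<open>t * t' - 1 - \<pi> * t * t'\<close>.\<close>

lemma conjugate_pi:
  assumes "r < h" "1 \<le> r"
  obtains e where "e \<in> S" "1 - z ^ (1 + p ^ r) = \<pi> * (1 + \<pi> ^ (p ^ r - 1) * (1 + \<pi> * e))"
proof -
  have pr: "1 \<le> p ^ r" using p_ge_3 by simp
  have "p ^ r \<le> p ^ (h - 1)" using assms p_ge_3 by (intro power_increasing) auto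
  then have "Suc (p ^ r) \<le> 2 * p ^ (h - 1)" using pr by linarith
  then obtain t where t: "t \<in> S" "of_nat p = \<pi> ^ Suc (p ^ r) * t"
    using pi_dvd_p by blast
  obtain t' where t': "t' \<in> S" "1 - z ^ p ^ r = \<pi> ^ p ^ r + of_nat p * t'"
    using one_minus_power_cong .
  have "\<pi> * \<pi> ^ (p ^ r - 1) = \<pi> ^ p ^ r" 
    using power_minus_mult[of "p ^ r" \<pi>] p_ge_3 by (simp add: mult.commute)
  then have "\<pi> * (1 + \<pi> ^ (p ^ r - 1) * (1 + \<pi> * (t * t' - 1 - \<pi> * t * t')))
      = \<pi> + \<pi> ^ p ^ r * (1 + \<pi> * (t * t' - 1 - \<pi> * t * t'))"
    by (simp add: distrib_left flip: mult.assoc)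
  also have "\<dots> = \<pi> + z * (\<pi> ^ p ^ r + \<pi> ^ Suc (p ^ r) * t * t')"
    by (simp add: algebra_simps)
  also have "\<dots> = \<pi> + z * (1 - z ^ p ^ r)" using t t' by simp
  also have "\<dots> = 1 - z ^ (1 + p ^ r)" by (simp add: algebra_simps)
  finally show ?thesis using that[of "t * t' - 1 - \<pi> * t * t'"] t t' by auto
qed

text \<open>Conjugation multiplies \<open>\<pi>\<close> by 1 + a with a divisible by
  \<open>\<pi> ^ (p ^ r - 1)\<close>; this makes p^r + m - 1 the level that belongs to the exponent
  m. Since 2 (p^r - 1) is at least p^r, the square of a joins the error term.\<close>

lemma conjugate_pi_power:
  assumes "r < h" "1 \<le> r" "1 \<le> m"
  obtains e where "e \<in> S"
    "(1 - z ^ (1 + p ^ r)) ^ m = \<pi> ^ m + \<pi> ^ (p ^ r + m - 1) * (of_nat m + \<pi> * e)"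
proof -
  obtain e where e: "e \<in> S" "1 - z ^ (1 + p ^ r) = \<pi> * (1 + \<pi> ^ (p ^ r - 1) * (1 + \<pi> * e))"
    using conjugate_pi[OF assms(1,2)] .
  define a where "a = \<pi> ^ (p ^ r - 1) * (1 + \<pi> * e)"
  have "p ^ 1 \<le> p ^ r" using assms p_ge_3 by (intro power_increasing) auto
  \<comment> \<open>With p^r = j + 2 the exponent 2 (p^r - 1) splits as (j + 1) + 1 + j, isolating
    one spare factor \<open>\<pi>\<close>.\<close>
  then obtain j where j: "p ^ r = Suc (Suc j)"
    using p_ge_3 by (metis Suc_le_D le_trans numeral_3_eq_3 power_one_right Suc_le_mono)
  have a: "a \<in> S" using e by (auto simp: a_def)
  obtain t where t: "t \<in> S" "(1 + a) ^ m = 1 + of_nat m * a + a ^ 2 * t"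
    using power_one_plus_order2[OF a] .
  have "a ^ 2 = \<pi> ^ Suc j * (\<pi> * (\<pi> ^ j * (1 + \<pi> * e) ^ 2))"
    by (simp add: a_def j power2_eq_square algebra_simps)
  then have "(1 + a) ^ m = 1 + \<pi> ^ Suc j *
     (of_nat m + \<pi> * (of_nat m * e + \<pi> ^ j * (1 + \<pi> * e) ^ 2 * t))"
    unfolding t(2) by (simp add: a_def j distrib_left mult_ac)
  moreover have "(1 - z ^ (1 + p ^ r)) ^ m = \<pi> ^ m * (1 + a) ^ m"
    using e by (simp add: a_def power_mult_distrib)
  moreover have "p ^ r + m - 1 = m + Suc j" using j by simp
  ultimately have "(1 - z ^ (1 + p ^ r)) ^ m = \<pi> ^ m + \<pi> ^ (p ^ r + m - 1) *
     (of_nat m + \<pi> * (of_nat m * e + \<pi> ^ j * (1 + \<pi> * e) ^ 2 * t))"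
    by (simp only: distrib_left mult_1_right power_add mult.assoc)
  moreover have "of_nat m * e + \<pi> ^ j * (1 + \<pi> * e) ^ 2 * t \<in> S"
    using e(1) t(1) by (intro add_closed mult_closed power_closed) auto
  ultimately show ?thesis by (rule that[rotated])
qed

end

section \<open>Nakayama's lemma\<close>

text \<open>The submodule S e_0 + ... + S e_(k-1), by recursion so that one generator can be removed
  at a time.\<close>

primrec left_span :: "('b, 'c) ring_scheme \<Rightarrow> 'b set \<Rightarrow> (nat \<Rightarrow> 'b) \<Rightarrow> nat \<Rightarrow> 'b set" where
  "left_span R S e 0 = {\<zero>\<^bsub>R\<^esub>}"
| "left_span R S e (Suc k) = {a \<oplus>\<^bsub>R\<^esub> r \<otimes>\<^bsub>R\<^esub> e k | a r. a \<in> left_span R S e k \<and> r \<in> S}"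

context ring
begin

lemma left_span_closed:
  assumes "S \<subseteq> carrier R" "\<And>i. i < k \<Longrightarrow> e i \<in> carrier R"
  shows "left_span R S e k \<subseteq> carrier R"
  using assms(2)
proof (induction k)
  case (Suc k)
  then have "left_span R S e k \<subseteq> carrier R" "e k \<in> carrier R" by simp_all
  then show ?case using assms(1) by (auto simp: subset_iff)
qed simp

lemma left_span_smult:
  assumes S: "subring S R" and "\<And>i. i < k \<Longrightarrow> e i \<in> carrier R"
    and "r \<in> S" "a \<in> left_span R S e k"
  shows "r \<otimes> a \<in> left_span R S e k"
  using assms(2,4)
proof (induction k arbitrary: a)
  case 0
  then show ?case using assms(3) subringE(1)[OF S] by auto
next
  case (Suc k)
  from Suc.prems(2) obtain b t where bt: "b \<in> left_span R S e k" "t \<in> S" "a = b \<oplus> t \<otimes> e k" by auto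
  have c: "b \<in> carrier R" "t \<in> carrier R" "e k \<in> carrier R" "r \<in> carrier R"
    using bt left_span_closed[of S k e] subringE(1)[OF S] Suc.prems assms(3) by auto
  have "r \<otimes> a = r \<otimes> b \<oplus> (r \<otimes> t) \<otimes> e k" using c by (simp add: bt r_distr m_assoc)
  moreover have "r \<otimes> t \<in> S" using subringE(6)[OF S assms(3) bt(2)] .
  ultimately show ?case using Suc.IH[of b] Suc.prems bt by auto
qed

lemma left_span_add:
  assumes S: "subring S R" and "\<And>i. i < k \<Longrightarrow> e i \<in> carrier R"
    and "a \<in> left_span R S e k" "b \<in> left_span R S e k"
  shows "a \<oplus> b \<in> left_span R S e k"
  using assms(2-)
proof (induction k arbitrary: a b)
  case 0
  then show ?case by auto
next
  case (Suc k)
  obtain a' t where a: "a' \<in> left_span R S e k" "t \<in> S" "a = a' \<oplus> t \<otimes> e k"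
    using Suc.prems(2) by auto
  obtain b' t' where b: "b' \<in> left_span R S e k" "t' \<in> S" "b = b' \<oplus> t' \<otimes> e k"
    using Suc.prems(3) by auto
  have c: "a' \<in> carrier R" "t \<in> carrier R" "b' \<in> carrier R" "t' \<in> carrier R" "e k \<in> carrier R"
    using a b left_span_closed[of S k e] subringE(1)[OF S] Suc.prems by auto
  have "a \<oplus> b = (a' \<oplus> b') \<oplus> (t \<oplus> t') \<otimes> e k"
    using c by (simp add: a b l_distr a_ac)
  moreover have "t \<oplus> t' \<in> S" using subringE(7)[OF S] a b by blast
  moreover have "a' \<oplus> b' \<in> left_span R S e k" using Suc a b by auto
  ultimately show ?case by auto
qed

lemma zero_in_left_span:
  assumes S: "subring S R" and "\<And>i. i < k \<Longrightarrow> e i \<in> carrier R"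
  shows "\<zero> \<in> left_span R S e k"
  using assms(2)
proof (induction k)
  case (Suc k)
  then have "\<zero> = \<zero> \<oplus> \<zero> \<otimes> e k" "\<zero> \<in> left_span R S e k" by simp_all
  then show ?case using subringE(2)[OF S] unfolding left_span.simps by blast
qed simp

text \<open>In a noncommutative setting there is no determinant trick, so generators are eliminated
  one by one. The last one satisfies e_k = n + c (b + r e_k); multiplying by a left inverse of 1 - c
  r expresses it through M and c times the span of the others.\<close>

lemma nakayama:
  assumes S: "subring S R" and "c \<in> S" and comm: "\<And>r. r \<in> S \<Longrightarrow> r \<otimes> c = c \<otimes> r"
    and inv: "\<And>r. r \<in> S \<Longrightarrow> \<exists>v\<in>S. v \<otimes> (\<one> \<oplus> c \<otimes> r) = \<one>"
    and M: "M \<subseteq> carrier R" "\<zero> \<in> M" "\<And>a b. a \<in> M \<Longrightarrow> b \<in> M \<Longrightarrow> a \<oplus> b \<in> M"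
      "\<And>r a. r \<in> S \<Longrightarrow> a \<in> M \<Longrightarrow> r \<otimes> a \<in> M"
    and "\<And>i. i < k \<Longrightarrow> e i \<in> carrier R"
    and "\<And>a. a \<in> left_span R S e k \<Longrightarrow> \<exists>n\<in>M. \<exists>b\<in>left_span R S e k. a = n \<oplus> c \<otimes> b"
  shows "left_span R S e k \<subseteq> M"
  using assms(9,10)
proof (induction k)
  case 0
  then show ?case using M by simp
next
  case (Suc k)
  let ?L = "left_span R S e"
  note sub = subringE(1)[OF S]
  have e: "\<And>i. i < k \<Longrightarrow> e i \<in> carrier R" "e k \<in> carrier R" using Suc.prems by auto
  have L: "?L k \<subseteq> carrier R" using left_span_closed[OF sub] e by simp
  note smult = left_span_smult[OF S e(1)] and add = left_span_add[OF S e(1)]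
  have zS: "\<zero> \<in> S" and oS: "\<one> \<in> S" using subringE(2,3)[OF S] .
  have c: "c \<in> carrier R" using assms(2) sub by blast
  have inL: "a \<oplus> r \<otimes> e k \<in> ?L (Suc k)" if "a \<in> ?L k" "r \<in> S" for a r
    using that by auto
  have inL': "a \<in> ?L (Suc k)" if "a \<in> ?L k" for a
    using inL[OF that zS] that L e by (simp add: subset_iff)
  have step: "\<exists>n\<in>M. \<exists>b\<in>?L k. \<exists>r\<in>S. a = n \<oplus> c \<otimes> (b \<oplus> r \<otimes> e k)"
    if "a \<in> ?L (Suc k)" for a
    using Suc.prems(2)[OF that] by auto
  have "\<zero> \<in> ?L k" by (rule zero_in_left_span[OF S e(1)])
  then have "e k \<in> ?L (Suc k)" using inL[of \<zero> \<one>] oS e by simp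
  then obtain n b r where nbr: "n \<in> M" "b \<in> ?L k" "r \<in> S" "e k = n \<oplus> c \<otimes> (b \<oplus> r \<otimes> e k)"
    using step by blast
  have "\<ominus> r \<in> S" using subringE(5)[OF S nbr(3)] .
  then obtain v where v: "v \<in> S" "v \<otimes> (\<one> \<oplus> c \<otimes> (\<ominus> r)) = \<one>" using inv by blast
  have cr: "n \<in> carrier R" "b \<in> carrier R" "r \<in> carrier R" "v \<in> carrier R"
    using nbr v L sub M(1) by auto
  have "(\<one> \<oplus> c \<otimes> (\<ominus> r)) \<otimes> e k = e k \<ominus> c \<otimes> r \<otimes> e k"
    using cr c e by (simp add: l_distr r_minus l_minus minus_eq)
  also have "\<dots> = n \<oplus> c \<otimes> b"
  proof -
    have "e k = (n \<oplus> c \<otimes> b) \<oplus> c \<otimes> r \<otimes> e k"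
      by (subst nbr(4)) (use cr c e in \<open>simp add: r_distr m_assoc a_assoc\<close>)
    then show ?thesis using cr c e by (metis add.inv_solve_right a_minus_def a_closed m_closed)
  qed
  finally have "v \<otimes> ((\<one> \<oplus> c \<otimes> (\<ominus> r)) \<otimes> e k) = v \<otimes> n \<oplus> c \<otimes> (v \<otimes> b)"
    using cr c e comm[OF v(1)] by (simp add: r_distr m_assoc[symmetric])
  then have ek: "e k = v \<otimes> n \<oplus> c \<otimes> (v \<otimes> b)"
    using v cr c e by (simp add: m_assoc[symmetric])
  \<comment> \<open>Substituting for e_k turns the relation modulo c into one within the smaller
    span, as the induction hypothesis demands.\<close>
  have "\<exists>n\<in>M. \<exists>b\<in>?L k. a = n \<oplus> c \<otimes> b" if a: "a \<in> ?L k" for a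
  proof -
    obtain n' b' r' where nbr': "n' \<in> M" "b' \<in> ?L k" "r' \<in> S" "a = n' \<oplus> c \<otimes> (b' \<oplus> r' \<otimes> e k)"
      using step[OF inL'[OF a]] by blast
    have cr': "n' \<in> carrier R" "b' \<in> carrier R" "r' \<in> carrier R"
      using nbr' L sub M(1) by auto
    have "a = (n' \<oplus> (c \<otimes> r' \<otimes> v) \<otimes> n) \<oplus> c \<otimes> (b' \<oplus> (r' \<otimes> c \<otimes> v) \<otimes> b)"
      unfolding nbr'(4) using cr cr' c e
      by (subst ek) (simp add: r_distr m_assoc a_ac)
    moreover have "n' \<oplus> (c \<otimes> r' \<otimes> v) \<otimes> n \<in> M"
      using nbr nbr' v assms(2) subringE(6)[OF S] by (intro M) auto
    moreover have "b' \<oplus> (r' \<otimes> c \<otimes> v) \<otimes> b \<in> ?L k"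
      using nbr nbr' v assms(2) subringE(6)[OF S] by (intro add smult) auto
    ultimately show ?thesis by blast
  qed
  then have Lk: "?L k \<subseteq> M" using Suc.IH e by blast
  then have "c \<otimes> (v \<otimes> b) \<in> M" using nbr(2) M(4)[OF v(1)] M(4)[OF assms(2)] by blast
  then have "e k \<in> M" by (subst ek) (rule M(3)[OF M(4)[OF v(1) nbr(1)]])
  then show ?case using Lk M(3,4) by auto
qed

text \<open>Nakayama for the left ideal generated by w = 1 + c x: from a c = c y one has a = a w - c
  y x, so this ideal is everything modulo c. The left inverse obtained has again the form 1 + c x',
  hence has a left inverse itself, which can only be w.\<close>

lemma one_plus_normal_Units:
  assumes S: "subring S R" and c: "c \<in> S" and comm: "\<And>r. r \<in> S \<Longrightarrow> r \<otimes> c = c \<otimes> r"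
    and inv: "\<And>r. r \<in> S \<Longrightarrow> \<exists>v\<in>S. v \<otimes> (\<one> \<oplus> c \<otimes> r) = \<one>"
    and e: "\<And>i. i < k \<Longrightarrow> e i \<in> carrier R" and span: "carrier R \<subseteq> left_span R S e k"
    and normal: "\<And>x. x \<in> carrier R \<Longrightarrow> \<exists>y\<in>carrier R. x \<otimes> c = c \<otimes> y"
    and x: "x \<in> carrier R"
  shows "\<one> \<oplus> c \<otimes> x \<in> Units R"
proof -
  have cc: "c \<in> carrier R" using c subringE(1)[OF S] by blast
  have left: "\<exists>v\<in>carrier R. v \<otimes> (\<one> \<oplus> c \<otimes> x) = \<one>" if x: "x \<in> carrier R" for x
  proof -
    define w where "w = \<one> \<oplus> c \<otimes> x"
    have w: "w \<in> carrier R" using x cc by (simp add: w_def)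
    define M where "M = (\<lambda>v. v \<otimes> w) ` carrier R"
    have "left_span R S e k \<subseteq> M"
    proof (rule nakayama[OF S c comm inv])
      show "M \<subseteq> carrier R" using w by (auto simp: M_def)
      show "\<zero> \<in> M" using w by (auto simp: M_def intro!: image_eqI[of _ _ \<zero>])
      show "a \<oplus> b \<in> M" if "a \<in> M" "b \<in> M" for a b
        using that w by (auto simp: M_def l_distr[symmetric])
      show "r \<otimes> a \<in> M" if "r \<in> S" "a \<in> M" for r a
        using that w subringE(1)[OF S] by (auto simp: M_def m_assoc[symmetric] subset_iff)
    next
      fix a assume "a \<in> left_span R S e k"
      then have a: "a \<in> carrier R" using left_span_closed[of S k e] subringE(1)[OF S] e by blast
      obtain y where y: "y \<in> carrier R" "a \<otimes> c = c \<otimes> y" using normal[OF a] by blast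
      have "a \<otimes> w = a \<oplus> c \<otimes> (y \<otimes> x)"
        using a x y cc by (simp add: w_def r_distr m_assoc[symmetric])
      then have "a = a \<otimes> w \<oplus> c \<otimes> (\<ominus> (y \<otimes> x))"
        using a x y cc by (simp add: r_minus a_assoc r_neg)
      then show "\<exists>n\<in>M. \<exists>b\<in>left_span R S e k. a = n \<oplus> c \<otimes> b"
        using a x y span unfolding M_def by blast
    qed (use e in auto)
    then have "\<one> \<in> M" using span by blast
    then show ?thesis by (fastforce simp: M_def simp flip: w_def)
  qed
  define w where "w = \<one> \<oplus> c \<otimes> x"
  have w: "w \<in> carrier R" using x cc by (simp add: w_def)
  obtain v where v: "v \<in> carrier R" "v \<otimes> w = \<one>" using left[OF x] by (auto simp: w_def)
  obtain y where y: "y \<in> carrier R" "v \<otimes> c = c \<otimes> y" using normal[OF v(1)] by blast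
  have "v \<otimes> w = v \<oplus> c \<otimes> (y \<otimes> x)"
    using v x y cc by (simp add: w_def r_distr m_assoc[symmetric])
  then have "v \<oplus> c \<otimes> (y \<otimes> x) = \<one>" using v by simp
  then have "v = \<one> \<oplus> c \<otimes> (\<ominus> (y \<otimes> x))"
    using v x y cc by (simp flip: \<open>v \<oplus> c \<otimes> (y \<otimes> x) = \<one>\<close> add: r_minus a_assoc r_neg)
  then obtain v' where v': "v' \<in> carrier R" "v' \<otimes> v = \<one>"
    using left[of "\<ominus> (y \<otimes> x)"] x y by auto
  have "v' = w" using v v' w by (metis m_assoc l_one r_one)
  then show ?thesis using v v' w unfolding Units_def w_def by blast
qed

end

section \<open>Cyclic orders\<close>

text \<open>For associativity in a cyclic algebra: a full period may start anywhere.\<close>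

lemma sum_periodic:
  fixes f :: "nat \<Rightarrow> 'b :: ab_group_add"
  assumes "\<And>j. f (j + N) = f j"
  shows "(\<Sum>j<N. f (j + i)) = (\<Sum>j<N. f j)"
proof (induction i)
  case (Suc i)
  have "(\<Sum>j<Suc N. f (j + i)) = f i + (\<Sum>j<N. f (j + Suc i))"
    by (subst sum.lessThan_Suc_shift) simp
  then show ?case using Suc assms[of i] by (simp add: add.commute)
qed simp

text \<open>With c invertible in S, u is a unit of the order, and coefficients can be taken with
  respect to every integral power of u without leaving S.\<close>

locale cyclic_order = unital_subring S for S :: "'b :: field set" +
  fixes g :: "'b \<Rightarrow> 'b" and N :: nat and c :: 'b
  assumes N_pos: "0 < N"
    and g_closed [simp, intro]: "a \<in> S \<Longrightarrow> g a \<in> S"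
    and g_add [simp]: "a \<in> S \<Longrightarrow> b \<in> S \<Longrightarrow> g (a + b) = g a + g b"
    and g_mult [simp]: "a \<in> S \<Longrightarrow> b \<in> S \<Longrightarrow> g (a * b) = g a * g b"
    and g_one [simp]: "g 1 = 1"
    and g_order: "a \<in> S \<Longrightarrow> (g ^^ N) a = a"
    and c_closed [simp, intro]: "c \<in> S" and inverse_c_closed [simp, intro]: "inverse c \<in> S"
    and c_nonzero [simp]: "c \<noteq> 0" and g_c [simp]: "g c = c"
begin

text \<open>The operations of \<open>cyclic_algebra\<close> do not depend on its coefficient set, so
  \<open>UNIV\<close> can stand for it before the carrier is cut down.\<close>

definition \<Delta> :: "(nat \<Rightarrow> 'b) ring" where
  "\<Delta> = (cyclic_algebra UNIV g N c)\<lparr>carrier := {a. (\<forall>j<N. a j \<in> S) \<and> (\<forall>j\<ge>N. a j = 0)}\<rparr>"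

lemma carrier_iff: "a \<in> carrier \<Delta> \<longleftrightarrow> (\<forall>j<N. a j \<in> S) \<and> (\<forall>j\<ge>N. a j = 0)"
  by (simp add: \<Delta>_def)

lemma coeff_closed [simp]: "a \<in> carrier \<Delta> \<Longrightarrow> a j \<in> S"
  by (cases "j < N") (auto simp: carrier_iff)

lemma g_zero [simp]: "g 0 = 0"
  using g_add[OF zero_closed zero_closed] by (metis add_0 add_cancel_right_right)

lemma g_uminus [simp]: "a \<in> S \<Longrightarrow> g (- a) = - g a"
  using g_add[of a "- a"] by (simp add: eq_neg_iff_add_eq_0 add.commute)

lemma funpow_g_closed [simp, intro]: "a \<in> S \<Longrightarrow> (g ^^ i) a \<in> S"
  by (induction i) auto

lemma funpow_g_add [simp]: "a \<in> S \<Longrightarrow> b \<in> S \<Longrightarrow> (g ^^ i) (a + b) = (g ^^ i) a + (g ^^ i) b"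
  by (induction i) auto

lemma funpow_g_mult [simp]: "a \<in> S \<Longrightarrow> b \<in> S \<Longrightarrow> (g ^^ i) (a * b) = (g ^^ i) a * (g ^^ i) b"
  by (induction i) auto

lemma funpow_g_fixed: "g a = a \<Longrightarrow> (g ^^ i) a = a"
  by (induction i) auto

lemma funpow_g_zero [simp]: "(g ^^ i) 0 = 0"
  by (simp add: funpow_g_fixed)

lemma funpow_g_one [simp]: "(g ^^ i) 1 = 1"
  by (simp add: funpow_g_fixed)

lemma funpow_g_sum: "(\<And>j. j \<in> I \<Longrightarrow> f j \<in> S) \<Longrightarrow> (g ^^ i) (sum f I) = (\<Sum>j\<in>I. (g ^^ i) (f j))"
proof (induction I rule: infinite_finite_induct)
  case (insert x F)
  then show ?case using sum_closed[of F f] by simp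
qed auto

lemma g_inverse_c: "g (inverse c) = inverse c"
proof -
  have "g (inverse c) * c = 1" using g_mult[of "inverse c" c] by simp
  then show ?thesis by (metis inverse_unique mult.commute inverse_inverse_eq)
qed

lemma g_power: "a \<in> S \<Longrightarrow> g (a ^ k) = g a ^ k"
  by (induction k) auto

lemma c_powi_closed [simp, intro]: "c powi x \<in> S"
  by (auto simp: power_int_def)

lemma g_c_powi [simp]: "g (c powi x) = c powi x"
  by (auto simp: power_int_def g_power g_inverse_c)

lemma funpow_g_c_powi [simp]: "(g ^^ i) (c powi x) = c powi x"
  by (simp add: funpow_g_fixed)

text \<open>
  The coefficients of \<open>b\<close> with respect to all powers \<open>u\<^sup>x\<close>, \<open>x \<in> \<int>\<close>, determined by \<open>u ^ N = c\<close>.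
  In these terms multiplication is a convolution without wrap-around.
\<close>

definition ext :: "(nat \<Rightarrow> 'b) \<Rightarrow> int \<Rightarrow> 'b" where
  "ext b x = b (nat (x mod int N)) * c powi (- (x div int N))"

lemma ext_closed [simp, intro]: "b \<in> carrier \<Delta> \<Longrightarrow> ext b x \<in> S"
  by (auto simp: ext_def)

lemma ext_nonneg: "k < N \<Longrightarrow> ext b (int k) = b k"
  by (simp add: ext_def flip: zmod_int zdiv_int)

lemma ext_neg: "0 < k \<Longrightarrow> k \<le> N \<Longrightarrow> ext b (- int k) = b (N - k) * c"
proof -
  assume k: "0 < k" "k \<le> N"
  have eq: "- int k = int (N - k) + int N * (-1)" using k by simp
  have "(- int k) mod int N = int (N - k)"
    unfolding eq mod_mult_self2 using k by (intro mod_pos_pos_trivial) auto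
  moreover have "(- int k) div int N = - 1"
    unfolding eq using k by (subst div_mult_self2) auto
  ultimately
  show ?thesis by (simp add: ext_def)
qed

lemma ext_shift: "ext b (x + int N * y) = ext b x * c powi (- y)"
proof -
  have "(x + int N * y) div int N = y + x div int N"
    using N_pos by (subst div_mult_self2) auto
  moreover have "c powi (- (y + x div int N)) = c powi (- (x div int N)) * c powi (- y)"
    using power_int_add[of c "- (x div int N)" "- y"] by (simp add: algebra_simps del: power_int_minus)
  ultimately show ?thesis by (simp add: ext_def del: power_int_minus)
qed

lemma mult_unfold:
  "(a \<otimes>\<^bsub>\<Delta>\<^esub> b) k = (if k < N then \<Sum>i<N. \<Sum>j<N. if i + j = k then a i * (g ^^ i) (b j)
     else if i + j = k + N then a i * (g ^^ i) (b j) * c else 0 else 0)"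
  unfolding \<Delta>_def cyclic_algebra_def
  by (simp only: monoid.select_convs partial_object.update_convs)

lemma mult_coeff:
  assumes "a \<in> carrier \<Delta>" "b \<in> carrier \<Delta>" "k < N"
  shows "(a \<otimes>\<^bsub>\<Delta>\<^esub> b) k = (\<Sum>i<N. a i * (g ^^ i) (ext b (int k - int i)))"
proof -
  have "(\<Sum>j<N. if i + j = k then a i * (g ^^ i) (b j)
          else if i + j = k + N then a i * (g ^^ i) (b j) * c else 0)
        = a i * (g ^^ i) (ext b (int k - int i))" (is "?l = ?r") if "i < N" for i
  proof (cases "i \<le> k")
    case True
    then have "?l = (\<Sum>j<N. if j = k - i then a i * (g ^^ i) (b j) else 0)"
      by (intro sum.cong) auto
    also have "\<dots> = a i * (g ^^ i) (b (k - i))" using assms(3) by simp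
    also have "b (k - i) = ext b (int (k - i))" using assms(3) by (simp add: ext_nonneg)
    finally show ?thesis using True by (simp add: of_nat_diff)
  next
    case False
    then have "?l = (\<Sum>j<N. if j = k + N - i then a i * (g ^^ i) (b j) * c else 0)"
      using that by (intro sum.cong) auto
    also have "k + N - i = N - (i - k)" using False that by linarith
    also have "(\<Sum>j<N. if j = N - (i - k) then a i * (g ^^ i) (b j) * c else 0)
        = a i * (g ^^ i) (b (N - (i - k)) * c)"
      using assms False that by (simp add: funpow_g_fixed)
    also have "b (N - (i - k)) * c = ext b (- int (i - k))"
      using False that by (subst ext_neg) auto
    finally show ?thesis using False by (simp add: of_nat_diff)
  qed
  then have "(\<Sum>i<N. \<Sum>j<N. if i + j = k then a i * (g ^^ i) (b j)
          else if i + j = k + N then a i * (g ^^ i) (b j) * c else 0)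
        = (\<Sum>i<N. a i * (g ^^ i) (ext b (int k - int i)))"
    by (intro sum.cong) simp_all
  moreover have "(a \<otimes>\<^bsub>\<Delta>\<^esub> b) k = (\<Sum>i<N. \<Sum>j<N. if i + j = k then a i * (g ^^ i) (b j)
          else if i + j = k + N then a i * (g ^^ i) (b j) * c else 0)"
    using assms(3) by (simp only: mult_unfold if_True)
  ultimately show ?thesis by (rule trans[rotated])
qed

lemma mult_coeff_ge: "N \<le> k \<Longrightarrow> (a \<otimes>\<^bsub>\<Delta>\<^esub> b) k = 0"
  unfolding mult_unfold by (simp only: not_less[symmetric] if_False)

lemma add_coeff [simp]: "(a \<oplus>\<^bsub>\<Delta>\<^esub> b) k = a k + b k"
  unfolding \<Delta>_def cyclic_algebra_def
  by (simp only: ring.select_convs monoid.select_convs partial_object.update_convs)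

lemma zero_coeff [simp]: "\<zero>\<^bsub>\<Delta>\<^esub> k = 0"
  unfolding \<Delta>_def cyclic_algebra_def
  by (simp only: ring.select_convs monoid.select_convs partial_object.update_convs)

lemma one_coeff [simp]: "\<one>\<^bsub>\<Delta>\<^esub> k = (if k = 0 then 1 else 0)"
  unfolding \<Delta>_def cyclic_algebra_def
  by (simp only: ring.select_convs monoid.select_convs partial_object.update_convs)

lemma order_mult_closed: "a \<in> carrier \<Delta> \<Longrightarrow> b \<in> carrier \<Delta> \<Longrightarrow> a \<otimes>\<^bsub>\<Delta>\<^esub> b \<in> carrier \<Delta>"
  unfolding carrier_iff[of "a \<otimes>\<^bsub>\<Delta>\<^esub> b"] by (auto simp: mult_coeff mult_coeff_ge intro!: sum_closed)

lemma ext_mult: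
  assumes "a \<in> carrier \<Delta>" "b \<in> carrier \<Delta>"
  shows "ext (a \<otimes>\<^bsub>\<Delta>\<^esub> b) x = (\<Sum>i<N. a i * (g ^^ i) (ext b (x - int i)))"
proof -
  define k q where "k = nat (x mod int N)" and "q = x div int N"
  have k: "k < N" using N_pos by (simp add: k_def nat_less_iff)
  have x: "x = int k + int N * q" using N_pos by (simp add: k_def q_def)
  have "ext (a \<otimes>\<^bsub>\<Delta>\<^esub> b) x = (a \<otimes>\<^bsub>\<Delta>\<^esub> b) k * c powi (- q)"
    unfolding ext_def k_def q_def ..
  also have "\<dots> = (\<Sum>i<N. a i * (g ^^ i) (ext b (int k - int i)) * c powi (- q))"
    unfolding mult_coeff[OF assms k] by (rule sum_distrib_right)
  also have "\<dots> = (\<Sum>i<N. a i * (g ^^ i) (ext b (x - int i)))"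
  proof (intro sum.cong refl)
    fix i
    have "x - int i = int k - int i + int N * q" using x by simp
    then have "ext b (x - int i) = ext b (int k - int i) * c powi (- q)"
      by (simp only: ext_shift)
    then show "a i * (g ^^ i) (ext b (int k - int i)) * c powi (- q) = a i * (g ^^ i) (ext b (x - int i))"
      using assms by (simp only: funpow_g_mult ext_closed c_powi_closed funpow_g_c_powi mult.assoc)
  qed
  finally show ?thesis .
qed

text \<open>Both triple products are sums of \<open>a i * f i j\<close> over one period of j, where
  j - i is the index of the coefficient of b; for (a b) e the period starts at 0, for a (b e) at i.
  The summand is periodic because a shift of j by N multiplies the coefficient of b by c^(-1) and
  that of e by c, and \<open>g ^^ N\<close> is the identity on S.\<close>

lemma order_mult_assoc:
  assumes "a \<in> carrier \<Delta>" "b \<in> carrier \<Delta>" "e \<in> carrier \<Delta>"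
  shows "a \<otimes>\<^bsub>\<Delta>\<^esub> b \<otimes>\<^bsub>\<Delta>\<^esub> e = a \<otimes>\<^bsub>\<Delta>\<^esub> (b \<otimes>\<^bsub>\<Delta>\<^esub> e)"
proof
  fix k
  show "(a \<otimes>\<^bsub>\<Delta>\<^esub> b \<otimes>\<^bsub>\<Delta>\<^esub> e) k = (a \<otimes>\<^bsub>\<Delta>\<^esub> (b \<otimes>\<^bsub>\<Delta>\<^esub> e)) k"
  proof (cases "k < N")
    case True
    define f where "f i j = (g ^^ i) (ext b (int j - int i)) * (g ^^ j) (ext e (int k - int j))" for i j
    have per: "f i (j + N) = f i j" for i j
    proof -
      have 1: "ext b (int (j + N) - int i) = ext b (int j - int i) * c powi (- 1)"
        using ext_shift[of b "int j - int i" 1] by (simp add: algebra_simps)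
      have 2: "ext e (int k - int (j + N)) = ext e (int k - int j) * c"
        using ext_shift[of e "int k - int j" "-1"] by (simp add: algebra_simps)
      have "(g ^^ (j + N)) (ext e (int k - int (j + N))) = (g ^^ j) (ext e (int k - int j)) * c"
        unfolding 2 using assms by (simp add: funpow_add g_order funpow_g_fixed)
      moreover have "(g ^^ i) (ext b (int (j + N) - int i)) = (g ^^ i) (ext b (int j - int i)) * c powi (- 1)"
        unfolding 1 by (simp only: funpow_g_mult ext_closed c_powi_closed funpow_g_c_powi assms)
      ultimately show ?thesis by (simp add: f_def)
    qed
    have "(a \<otimes>\<^bsub>\<Delta>\<^esub> b \<otimes>\<^bsub>\<Delta>\<^esub> e) k = (\<Sum>j<N. ext (a \<otimes>\<^bsub>\<Delta>\<^esub> b) (int j) * (g ^^ j) (ext e (int k - int j)))"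
      using assms True by (simp add: mult_coeff order_mult_closed ext_nonneg)
    also have "\<dots> = (\<Sum>j<N. \<Sum>i<N. a i * f i j)"
      using assms by (simp add: ext_mult f_def sum_distrib_right mult.assoc)
    also have "\<dots> = (\<Sum>i<N. a i * (\<Sum>j<N. f i j))"
      by (subst sum.swap) (simp add: sum_distrib_left)
    also have "\<dots> = (\<Sum>i<N. a i * (\<Sum>j<N. f i (j + i)))"
      using sum_periodic[of "f _" N] per by simp
    also have "\<dots> = (\<Sum>i<N. a i * (g ^^ i) (ext (b \<otimes>\<^bsub>\<Delta>\<^esub> e) (int k - int i)))"
    proof (intro sum.cong refl arg_cong2[where f = "(*)"])
      fix i
      have "(g ^^ i) (ext (b \<otimes>\<^bsub>\<Delta>\<^esub> e) (int k - int i))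
          = (\<Sum>j<N. (g ^^ i) (b j * (g ^^ j) (ext e (int k - int i - int j))))"
        using assms by (simp add: ext_mult funpow_g_sum)
      also have "\<dots> = (\<Sum>j<N. f i (j + i))"
      proof (intro sum.cong refl)
        fix j assume "j \<in> {..<N}"
        then show "(g ^^ i) (b j * (g ^^ j) (ext e (int k - int i - int j))) = f i (j + i)"
          using assms by (simp add: f_def ext_nonneg add.commute[of j i] funpow_add algebra_simps)
      qed
      finally show "(\<Sum>j<N. f i (j + i)) = (g ^^ i) (ext (b \<otimes>\<^bsub>\<Delta>\<^esub> e) (int k - int i))" ..
    qed
    also have "\<dots> = (a \<otimes>\<^bsub>\<Delta>\<^esub> (b \<otimes>\<^bsub>\<Delta>\<^esub> e)) k"
      using assms True by (simp add: mult_coeff order_mult_closed)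
    finally show ?thesis .
  qed (simp add: mult_coeff_ge)
qed

section \<open>Scalars and the generator u inside the order\<close>

lemma single_term_closed [simp, intro]: "b \<in> S \<Longrightarrow> j < N \<Longrightarrow> single_term b j \<in> carrier \<Delta>"
  by (auto simp: carrier_iff single_term_def)

lemma scalar_mult:
  assumes "b \<in> S" "y \<in> carrier \<Delta>"
  shows "single_term b 0 \<otimes>\<^bsub>\<Delta>\<^esub> y = (\<lambda>k. b * y k)"
proof
  fix k
  show "(single_term b 0 \<otimes>\<^bsub>\<Delta>\<^esub> y) k = b * y k"
  proof (cases "k < N")
    case True
    then have "(single_term b 0 \<otimes>\<^bsub>\<Delta>\<^esub> y) k = (\<Sum>i<N. if i = 0 then b * ext y (int k) else 0)"
      unfolding mult_coeff[OF single_term_closed[OF assms(1) N_pos] assms(2) True]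
      by (intro sum.cong) (auto simp: single_term_def)
    then show ?thesis using True N_pos by (simp add: ext_nonneg)
  next
    case False
    then show ?thesis using assms by (simp add: mult_coeff_ge carrier_iff)
  qed
qed

lemma ext_scalar:
  assumes "k < N" "i < N"
  shows "ext (single_term b 0) (int k - int i) = (if i = k then b else 0)"
proof (cases "i \<le> k")
  case True
  then have "int k - int i = int (k - i)" by simp
  then show ?thesis using True assms ext_nonneg[of "k - i" "single_term b 0"]
    by (simp add: single_term_def)
next
  case False
  then have "int k - int i = - int (i - k)" by simp
  then show ?thesis using False assms ext_neg[of "i - k" "single_term b 0"]
    by (simp add: single_term_def)
qed

lemma mult_scalar:
  assumes "b \<in> S" "y \<in> carrier \<Delta>"
  shows "y \<otimes>\<^bsub>\<Delta>\<^esub> single_term b 0 = (\<lambda>k. y k * (g ^^ k) b)"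
proof
  fix k
  show "(y \<otimes>\<^bsub>\<Delta>\<^esub> single_term b 0) k = y k * (g ^^ k) b"
  proof (cases "k < N")
    case True
    then have "(y \<otimes>\<^bsub>\<Delta>\<^esub> single_term b 0) k = (\<Sum>i<N. if i = k then y k * (g ^^ k) b else 0)"
      unfolding mult_coeff[OF assms(2) single_term_closed[OF assms(1) N_pos] True]
      using True by (intro sum.cong) (auto simp: ext_scalar)
    then show ?thesis using True by simp
  next
    case False
    then show ?thesis using assms by (simp add: mult_coeff_ge carrier_iff)
  qed
qed

lemma one_eq_scalar: "\<one>\<^bsub>\<Delta>\<^esub> = single_term 1 0"
  by (auto simp: single_term_def)

lemma ring_order: "ring \<Delta>"
proof (rule ringI)
  show "abelian_group \<Delta>"
  proof (rule abelian_groupI)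
    fix x assume x: "x \<in> carrier \<Delta>"
    then show "\<exists>y\<in>carrier \<Delta>. y \<oplus>\<^bsub>\<Delta>\<^esub> x = \<zero>\<^bsub>\<Delta>\<^esub>"
      by (intro bexI[of _ "\<lambda>k. - x k"]) (auto simp: carrier_iff)
  qed (auto simp: carrier_iff)
  show "monoid \<Delta>"
  proof (rule monoidI)
    show "\<one>\<^bsub>\<Delta>\<^esub> \<in> carrier \<Delta>" using N_pos by (simp add: one_eq_scalar)
    fix x assume "x \<in> carrier \<Delta>"
    then show "\<one>\<^bsub>\<Delta>\<^esub> \<otimes>\<^bsub>\<Delta>\<^esub> x = x" "x \<otimes>\<^bsub>\<Delta>\<^esub> \<one>\<^bsub>\<Delta>\<^esub> = x"
      by (simp_all add: one_eq_scalar scalar_mult mult_scalar)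
  qed (auto simp: order_mult_closed order_mult_assoc)
next
  fix x y e assume xye: "x \<in> carrier \<Delta>" "y \<in> carrier \<Delta>" "e \<in> carrier \<Delta>"
  have add: "a \<oplus>\<^bsub>\<Delta>\<^esub> b \<in> carrier \<Delta>" if "a \<in> carrier \<Delta>" "b \<in> carrier \<Delta>" for a b
    using that by (auto simp: carrier_iff)
  have ext: "ext (a \<oplus>\<^bsub>\<Delta>\<^esub> b) k = ext a k + ext b k" for a b k
    by (simp add: ext_def algebra_simps)
  show "(x \<oplus>\<^bsub>\<Delta>\<^esub> y) \<otimes>\<^bsub>\<Delta>\<^esub> e = x \<otimes>\<^bsub>\<Delta>\<^esub> e \<oplus>\<^bsub>\<Delta>\<^esub> y \<otimes>\<^bsub>\<Delta>\<^esub> e"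
  proof
    fix k show "((x \<oplus>\<^bsub>\<Delta>\<^esub> y) \<otimes>\<^bsub>\<Delta>\<^esub> e) k = (x \<otimes>\<^bsub>\<Delta>\<^esub> e \<oplus>\<^bsub>\<Delta>\<^esub> y \<otimes>\<^bsub>\<Delta>\<^esub> e) k"
      using xye add by (cases "k < N") (simp_all add: mult_coeff mult_coeff_ge distrib_right sum.distrib)
  qed
  show "e \<otimes>\<^bsub>\<Delta>\<^esub> (x \<oplus>\<^bsub>\<Delta>\<^esub> y) = e \<otimes>\<^bsub>\<Delta>\<^esub> x \<oplus>\<^bsub>\<Delta>\<^esub> e \<otimes>\<^bsub>\<Delta>\<^esub> y"
  proof
    fix k show "(e \<otimes>\<^bsub>\<Delta>\<^esub> (x \<oplus>\<^bsub>\<Delta>\<^esub> y)) k = (e \<otimes>\<^bsub>\<Delta>\<^esub> x \<oplus>\<^bsub>\<Delta>\<^esub> e \<otimes>\<^bsub>\<Delta>\<^esub> y) k"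
      using xye add by (cases "k < N") (simp_all add: mult_coeff mult_coeff_ge ext distrib_left sum.distrib)
  qed
qed

sublocale order: ring \<Delta>
  by (rule ring_order)

lemma minus_coeff:
  assumes "a \<in> carrier \<Delta>" "b \<in> carrier \<Delta>"
  shows "(a \<ominus>\<^bsub>\<Delta>\<^esub> b) k = a k - b k"
proof -
  have "(a \<ominus>\<^bsub>\<Delta>\<^esub> b) \<oplus>\<^bsub>\<Delta>\<^esub> b = a"
    using assms by (simp add: order.minus_eq order.a_assoc order.l_neg)
  then have "(a \<ominus>\<^bsub>\<Delta>\<^esub> b) k + b k = a k" by (metis add_coeff)
  then show ?thesis by (simp add: eq_diff_eq)
qed

lemma scalar_pow: "b \<in> S \<Longrightarrow> single_term b 0 [^]\<^bsub>\<Delta>\<^esub> (k :: nat) = single_term (b ^ k) 0"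
proof (induction k)
  case (Suc k)
  then show ?case using N_pos
    by (simp add: scalar_mult) (auto simp: single_term_def)
qed (simp add: one_eq_scalar)

lemma u_commute_scalar:
  assumes "b \<in> S" "1 < N"
  shows "single_term 1 1 \<otimes>\<^bsub>\<Delta>\<^esub> single_term b 0 = single_term (g b) 0 \<otimes>\<^bsub>\<Delta>\<^esub> single_term 1 1"
  using assms by (simp add: mult_scalar scalar_mult) (auto simp: single_term_def)

lemma u_mult:
  assumes "x \<in> carrier \<Delta>" "1 < N" "k < N"
  shows "(single_term 1 1 \<otimes>\<^bsub>\<Delta>\<^esub> x) k = g (if k = 0 then x (N - 1) * c else x (k - 1))"
proof -
  have "(single_term 1 1 \<otimes>\<^bsub>\<Delta>\<^esub> x) k = (\<Sum>i<N. if i = 1 then g (ext x (int k - 1)) else 0)"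
    unfolding mult_coeff[OF single_term_closed[OF one_closed assms(2)] assms(1,3)]
    by (intro sum.cong) (auto simp: single_term_def)
  also have "\<dots> = g (ext x (int k - 1))" using assms by simp
  also have "ext x (int k - 1) = (if k = 0 then x (N - 1) * c else x (k - 1))"
    using assms ext_neg[of 1 x] ext_nonneg[of "k - 1" x] by (auto simp: of_nat_diff)
  finally show ?thesis .
qed

lemma u_commute_fixed:
  assumes x: "x \<in> carrier \<Delta>" "\<And>j. j < N \<Longrightarrow> g (x j) = x j" and N: "1 < N"
  shows "single_term 1 1 \<otimes>\<^bsub>\<Delta>\<^esub> x = x \<otimes>\<^bsub>\<Delta>\<^esub> single_term 1 1"
proof
  fix k
  let ?u = "single_term (1 :: 'b) 1"
  have u: "?u \<in> carrier \<Delta>" using N by simp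
  show "(?u \<otimes>\<^bsub>\<Delta>\<^esub> x) k = (x \<otimes>\<^bsub>\<Delta>\<^esub> ?u) k"
  proof (cases "k < N")
    case True
    \<comment> \<open>The only contributing index is the cyclic predecessor of k; for k = 0 the
      product u^(N-1) u wraps round and yields the factor c.\<close>
    define i\<^sub>0 d where "i\<^sub>0 = (if k = 0 then N - 1 else k - 1)" and "d = (if k = 0 then c else 1)"
    have i0: "i\<^sub>0 < N" and d: "g d = d" using True by (auto simp: i\<^sub>0_def d_def)
    have ext: "ext ?u (int k - int i) = (if i = i\<^sub>0 then d else 0)" if "i < N" for i
    proof (cases "i \<le> k")
      case ik: True
      then have "int k - int i = int (k - i)" by simp
      then show ?thesis using True ik N ext_nonneg[of "k - i" ?u]
        by (auto simp: single_term_def i\<^sub>0_def d_def)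
    next
      case False
      then have "int k - int i = - int (i - k)" by simp
      then show ?thesis using True False that N ext_neg[of "i - k" ?u]
        by (auto simp: single_term_def i\<^sub>0_def d_def)
    qed
    have "(x \<otimes>\<^bsub>\<Delta>\<^esub> ?u) k = (\<Sum>i<N. if i = i\<^sub>0 then x i * d else 0)"
      unfolding mult_coeff[OF x(1) u True]
    proof (intro sum.cong refl)
      fix i assume "i \<in> {..<N}"
      then have "i < N" by simp
      show "x i * (g ^^ i) (ext ?u (int k - int i)) = (if i = i\<^sub>0 then x i * d else 0)"
        unfolding ext[OF \<open>i < N\<close>] by (simp add: funpow_g_fixed d)
    qed
    also have "\<dots> = g (if k = 0 then x (N - 1) * c else x (k - 1))"
      using i0 True x by (auto simp: i\<^sub>0_def d_def)
    also have "\<dots> = (?u \<otimes>\<^bsub>\<Delta>\<^esub> x) k" using u_mult[OF x(1) N True] ..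
    finally show ?thesis ..
  qed (simp add: mult_coeff_ge)
qed

text \<open>From u^N = c the inverse is c^(-1) u^(N-1); its coefficients are fixed by g, so this
  right inverse commutes with u.\<close>

lemma u_Units:
  assumes "1 < N"
  shows "single_term 1 1 \<in> Units \<Delta>"
proof -
  let ?u = "single_term (1 :: 'b) 1" and ?v = "single_term (inverse c) (N - 1)"
  have v: "?v \<in> carrier \<Delta>" using assms by simp
  have "?u \<otimes>\<^bsub>\<Delta>\<^esub> ?v = \<one>\<^bsub>\<Delta>\<^esub>"
  proof
    fix k show "(?u \<otimes>\<^bsub>\<Delta>\<^esub> ?v) k = \<one>\<^bsub>\<Delta>\<^esub> k"
    proof (cases "k < N")
      case True
      then show ?thesis using u_mult[OF v assms True] by (auto simp: single_term_def)
    next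
      case False
      then show ?thesis using N_pos by (simp add: mult_coeff_ge)
    qed
  qed
  moreover have "?u \<otimes>\<^bsub>\<Delta>\<^esub> ?v = ?v \<otimes>\<^bsub>\<Delta>\<^esub> ?u"
    using v assms g_inverse_c by (intro u_commute_fixed) (auto simp: single_term_def)
  ultimately show ?thesis using v assms unfolding Units_def by auto
qed

end

section \<open>Approximation by commutators\<close>

text \<open>R plays the role of O[[T]]: small enough to be fixed by g, so that an element with
  coefficients in R commutes with u, yet large enough to represent every class of S modulo
  \<open>\<pi>\<close>.\<close>

locale cyclotomic_cyclic_order =
  cyclotomic_subring S p "r + s" z + cyclic_order S g "p ^ s" c + R: unital_subring R
  for S :: "'b :: field set" and p r s :: nat and z :: 'b and g :: "'b \<Rightarrow> 'b" and c :: 'b and R +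
  assumes r_pos: "1 \<le> r" and s_pos: "1 \<le> s"
    and R_subset: "R \<subseteq> S"
    and g_fixes_R: "a \<in> R \<Longrightarrow> g a = a"
    and g_z: "g z = z ^ (1 + p ^ r)"
    and residue: "b \<in> S \<Longrightarrow> \<exists>a\<in>R. \<exists>t\<in>S. b = a + \<pi> * t"
begin

abbreviation "N \<equiv> p ^ s"
abbreviation "P \<equiv> single_term \<pi> 0"
abbreviation "u \<equiv> single_term (1 :: 'b) 1"

lemma N_gt_1: "1 < N"
  using p_ge_3 s_pos by (intro one_less_power) auto

lemma scalar_closed [simp, intro]: "a \<in> S \<Longrightarrow> single_term a 0 \<in> carrier \<Delta>"
  using N_pos by simp

lemma scalar_coeff:
  "b \<in> S \<Longrightarrow> y \<in> carrier \<Delta> \<Longrightarrow> (single_term b 0 \<otimes>\<^bsub>\<Delta>\<^esub> y) k = b * y k"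
  by (simp add: scalar_mult)

lemma scalar_scalar_mult:
  "a \<in> S \<Longrightarrow> b \<in> S \<Longrightarrow> single_term a 0 \<otimes>\<^bsub>\<Delta>\<^esub> single_term b 0 = single_term (a * b) 0"
  by (simp add: scalar_mult) (auto simp: single_term_def)

lemma scalar_add: "single_term a 0 \<oplus>\<^bsub>\<Delta>\<^esub> single_term b 0 = single_term (a + b) 0"
  by (auto simp: single_term_def)

lemma subring_scalars: "subring ((\<lambda>a. single_term a 0) ` S) \<Delta>"
proof (rule order.subringI)
  fix h assume "h \<in> (\<lambda>a. single_term a 0) ` S"
  then obtain a where a: "a \<in> S" "h = single_term a 0" by blast
  have "single_term (- a) 0 \<oplus>\<^bsub>\<Delta>\<^esub> h = \<zero>\<^bsub>\<Delta>\<^esub>"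
    unfolding a scalar_add by (auto simp: single_term_def)
  then have "\<ominus>\<^bsub>\<Delta>\<^esub> h = single_term (- a) 0"
    using a by (intro order.minus_equality) auto
  then show "\<ominus>\<^bsub>\<Delta>\<^esub> h \<in> (\<lambda>a. single_term a 0) ` S" using a by auto
qed (auto simp: one_eq_scalar scalar_scalar_mult scalar_add)

lemma funpow_g_pi:
  obtains t where "t \<in> S" "(g ^^ k) \<pi> = \<pi> * t"
proof -
  have "\<exists>t\<in>S. (g ^^ k) \<pi> = \<pi> * t"
  proof (induction k)
    case 0
    show ?case by (rule bexI[of _ 1]) auto
  next
    case (Suc k)
    then obtain t where t: "t \<in> S" "(g ^^ k) \<pi> = \<pi> * t" by blast
    obtain e where e: "e \<in> S" "z ^ (1 + p ^ r) = 1 + (z - 1) * e"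
      using power_diff_one_dvd[OF z_closed] by blast
    have "g \<pi> = g 1 + g (- z)" using g_add[of 1 "- z"] by simp
    also have "\<dots> = \<pi> * e" using e by (simp add: g_z algebra_simps)
    finally have "(g ^^ Suc k) \<pi> = \<pi> * (e * g t)" using t by simp
    then show ?case using e t by blast
  qed
  then show ?thesis using that by blast
qed

text \<open>Passing P to the left across u^k replaces \<open>\<pi>\<close> by
  \<open>(g ^^ k) \<pi>\<close>, again a multiple of \<open>\<pi>\<close>; the quotients
  \<open>t k\<close> correct the coefficients of x.\<close>

lemma P_normal:
  assumes "x \<in> carrier \<Delta>"
  obtains y where "y \<in> carrier \<Delta>" "x \<otimes>\<^bsub>\<Delta>\<^esub> P = P \<otimes>\<^bsub>\<Delta>\<^esub> y"
proof -
  obtain t where t: "\<And>k. t k \<in> S" "\<And>k. (g ^^ k) \<pi> = \<pi> * t k"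
  proof -
    have "\<exists>t. t \<in> S \<and> (g ^^ k) \<pi> = \<pi> * t" for k by (rule funpow_g_pi[of k]) blast
    then show ?thesis using that by metis
  qed
  define y where "y = (\<lambda>k. x k * t k)"
  have "y \<in> carrier \<Delta>" using assms t by (auto simp: y_def carrier_iff)
  moreover have "x \<otimes>\<^bsub>\<Delta>\<^esub> P = P \<otimes>\<^bsub>\<Delta>\<^esub> y"
    using assms \<open>y \<in> carrier \<Delta>\<close> by (simp add: mult_scalar scalar_mult t y_def mult_ac)
  ultimately show ?thesis using that by blast
qed

lemma carrier_subset_span:
  "carrier \<Delta> \<subseteq> left_span \<Delta> ((\<lambda>a. single_term a 0) ` S) (single_term 1) N"
proof -
  have "a \<in> left_span \<Delta> ((\<lambda>a. single_term a 0) ` S) (single_term 1) k"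
    if "a \<in> carrier \<Delta>" "\<And>j. k \<le> j \<Longrightarrow> a j = 0" "k \<le> N" for a k
    using that
  proof (induction k arbitrary: a)
    case 0
    then have "a = \<zero>\<^bsub>\<Delta>\<^esub>" by auto
    then show ?case by (simp only: left_span.simps singleton_iff)
  next
    case (Suc k)
    have "a(k := 0) \<in> left_span \<Delta> ((\<lambda>a. single_term a 0) ` S) (single_term 1) k"
      using Suc.prems by (intro Suc.IH) (auto simp: carrier_iff)
    moreover have "a = a(k := 0) \<oplus>\<^bsub>\<Delta>\<^esub> single_term (a k) 0 \<otimes>\<^bsub>\<Delta>\<^esub> single_term 1 k"
    proof
      fix j
      have "(single_term (a k) 0 \<otimes>\<^bsub>\<Delta>\<^esub> single_term 1 k) j = a k * single_term 1 k j"
        using Suc.prems by (intro scalar_coeff) auto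
      then show "a j = (a(k := 0) \<oplus>\<^bsub>\<Delta>\<^esub> single_term (a k) 0 \<otimes>\<^bsub>\<Delta>\<^esub> single_term 1 k) j"
        by (simp add: single_term_def)
    qed
    moreover have "a k \<in> S" using Suc.prems by simp
    ultimately show ?case unfolding left_span.simps by blast
  qed
  then show ?thesis by (auto simp: carrier_iff)
qed

text \<open>Scalars from S commute with P, and the powers of u generate the order over them, while a
  general element merely normalises P. These are the two roles separated in
  \<open>one_plus_normal_Units\<close>.\<close>

lemma one_plus_P_Units:
  assumes "x \<in> carrier \<Delta>"
  shows "\<one>\<^bsub>\<Delta>\<^esub> \<oplus>\<^bsub>\<Delta>\<^esub> P \<otimes>\<^bsub>\<Delta>\<^esub> x \<in> Units \<Delta>"
proof (rule order.one_plus_normal_Units[OF subring_scalars])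
  show "single_term 1 i \<in> carrier \<Delta>" if "i < N" for i using that by simp
  show "carrier \<Delta> \<subseteq> left_span \<Delta> ((\<lambda>a. single_term a 0) ` S) (single_term 1) N"
    by (rule carrier_subset_span)
  fix q assume "q \<in> (\<lambda>a. single_term a 0) ` S"
  then obtain a where a: "a \<in> S" "q = single_term a 0" by blast
  then show "q \<otimes>\<^bsub>\<Delta>\<^esub> P = P \<otimes>\<^bsub>\<Delta>\<^esub> q" by (simp add: scalar_scalar_mult mult.commute)
  obtain b where b: "b \<in> S" "(1 + \<pi> * a) * b = 1" using unit_mod_pi[OF a(1)] .
  then have "single_term b 0 \<otimes>\<^bsub>\<Delta>\<^esub> (\<one>\<^bsub>\<Delta>\<^esub> \<oplus>\<^bsub>\<Delta>\<^esub> P \<otimes>\<^bsub>\<Delta>\<^esub> q) = \<one>\<^bsub>\<Delta>\<^esub>"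
    using a by (simp add: one_eq_scalar scalar_scalar_mult scalar_add mult.commute)
  then show "\<exists>v\<in>(\<lambda>a. single_term a 0) ` S. v \<otimes>\<^bsub>\<Delta>\<^esub> (\<one>\<^bsub>\<Delta>\<^esub> \<oplus>\<^bsub>\<Delta>\<^esub> P \<otimes>\<^bsub>\<Delta>\<^esub> q) = \<one>\<^bsub>\<Delta>\<^esub>"
    using b by blast
qed (use assms P_normal in \<open>blast+\<close>)

text \<open>Write b = a + \<open>\<pi>\<close> t with a in R, and k m + l p = 1. Then -k a solves
  the congruence, because the defect l p a is divisible by \<open>\<pi>\<close>.\<close>

lemma residue_solution:
  assumes "\<not> p dvd m" "b \<in> S"
  obtains a t where "a \<in> R" "t \<in> S" "b + of_nat m * a = \<pi> * t"
proof -
  have "coprime (int m) (int p)"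
    using prime_imp_coprime[OF prime_p assms(1)] by (simp add: coprime_commute)
  then obtain k l where kl: "k * int m + l * int p = 1"
    by (metis bezout_int coprime_imp_gcd_eq_1)
  obtain a t where at: "a \<in> R" "t \<in> S" "b = a + \<pi> * t" using residue[OF assms(2)] by blast
  obtain q where q: "q \<in> S" "of_nat p = \<pi> ^ 1 * q"
    using pi_dvd_p[of 1] p_ge_3 by auto
  have "of_int (k * int m + l * int p) = (1 :: 'b)" unfolding kl by simp
  then have 1: "of_int k * of_nat m + of_int l * of_nat p = (1 :: 'b)" by simp
  have "b + of_nat m * (of_int (- k) * a) = \<pi> * t + (1 - of_int k * of_nat m) * a"
    using at by (simp add: algebra_simps)
  also have "1 - of_int k * of_nat m = (of_int l * of_nat p :: 'b)"
    using 1 by (simp add: algebra_simps)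
  also have "\<pi> * t + of_int l * of_nat p * a = \<pi> * (t + of_int l * q * a)"
    unfolding q(2) by (simp add: algebra_simps)
  finally show ?thesis
    using that[of "of_int (- k) * a" "t + of_int l * q * a"] at q R_subset by auto
qed

theorem commutator_approximation:
  assumes y: "y \<in> carrier \<Delta>" and m: "1 \<le> m" "\<not> p dvd m" and n: "n = p ^ r + m - 1"
    and d: "d = \<one>\<^bsub>\<Delta>\<^esub> \<oplus>\<^bsub>\<Delta>\<^esub> P [^]\<^bsub>\<Delta>\<^esub> n \<otimes>\<^bsub>\<Delta>\<^esub> y"
  shows "\<exists>x \<in> carrier \<Delta>.
           \<one>\<^bsub>\<Delta>\<^esub> \<ominus>\<^bsub>\<Delta>\<^esub> P [^]\<^bsub>\<Delta>\<^esub> m \<otimes>\<^bsub>\<Delta>\<^esub> x \<in> Units \<Delta> \<and>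
           d \<ominus>\<^bsub>\<Delta>\<^esub> commutator \<Delta> u (\<one>\<^bsub>\<Delta>\<^esub> \<ominus>\<^bsub>\<Delta>\<^esub> P [^]\<^bsub>\<Delta>\<^esub> m \<otimes>\<^bsub>\<Delta>\<^esub> x)
             \<in> (P [^]\<^bsub>\<Delta>\<^esub> (n + 1)) <#\<^bsub>\<Delta>\<^esub> carrier \<Delta>"
proof -
  have [simp, intro]: "\<pi> \<in> S" by auto
  have "\<exists>a t. a \<in> R \<and> t \<in> S \<and> y j + of_nat m * a = \<pi> * t" for j
    by (rule residue_solution[OF m(2) coeff_closed[OF y], of j]) blast
  then obtain a t where at: "\<And>j. a j \<in> R" "\<And>j. t j \<in> S" "\<And>j. y j + of_nat m * a j = \<pi> * t j"
    by metis
  \<comment> \<open>The truncation puts x and q into the order, whose elements vanish from index N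
    on.\<close>
  define x where "x = (\<lambda>j. if j < N then a j else 0)"
  define q where "q = (\<lambda>j. if j < N then t j else 0)"
  have x: "x \<in> carrier \<Delta>" and q: "q \<in> carrier \<Delta>"
    using at R_subset by (auto simp: x_def q_def carrier_iff)
  have yx: "y j + of_nat m * x j = \<pi> * q j" for j
    using at(3)[of j] y by (auto simp: x_def q_def carrier_iff)
  obtain e where e: "e \<in> S"
    "(1 - z ^ (1 + p ^ r)) ^ m = \<pi> ^ m + \<pi> ^ n * (of_nat m + \<pi> * e)"
    using conjugate_pi_power[of r m] r_pos s_pos m(1) n by auto
  \<comment> \<open>\<open>\<gamma>\<close> is g applied to \<open>\<pi> ^ m\<close>, so that
    \<open>w'\<close> below turns out to be the conjugate of w by u.\<close>
  define \<gamma> where "\<gamma> = (1 - z ^ (1 + p ^ r)) ^ m"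
  have \<gamma>: "\<gamma> \<in> S" "g (\<pi> ^ m) = \<gamma>"
    using g_add[of 1 "- z"] by (auto simp: \<gamma>_def g_power g_z)
  define w where "w = \<one>\<^bsub>\<Delta>\<^esub> \<ominus>\<^bsub>\<Delta>\<^esub> P [^]\<^bsub>\<Delta>\<^esub> m \<otimes>\<^bsub>\<Delta>\<^esub> x"
  define w' where "w' = \<one>\<^bsub>\<Delta>\<^esub> \<ominus>\<^bsub>\<Delta>\<^esub> single_term \<gamma> 0 \<otimes>\<^bsub>\<Delta>\<^esub> x"
  have P: "P [^]\<^bsub>\<Delta>\<^esub> k = single_term (\<pi> ^ k) 0" for k :: nat by (simp add: scalar_pow)
  have one: "\<one>\<^bsub>\<Delta>\<^esub> \<in> carrier \<Delta>" by simp
  have u: "u \<in> Units \<Delta>" "u \<in> carrier \<Delta>" using u_Units[OF N_gt_1] N_gt_1 by auto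
  have w: "w \<in> Units \<Delta>"
  proof -
    \<comment> \<open>One factor P is split off, possible by \<open>1 \<le> m\<close>, to reach the
      form 1 + P x' of a known unit.\<close>
    have "w = \<one>\<^bsub>\<Delta>\<^esub> \<oplus>\<^bsub>\<Delta>\<^esub> P \<otimes>\<^bsub>\<Delta>\<^esub> (single_term (- (\<pi> ^ (m - 1))) 0 \<otimes>\<^bsub>\<Delta>\<^esub> x)"
    proof
      fix k
      have "\<pi> ^ m = \<pi> * \<pi> ^ (m - 1)" using m(1) by (cases m) auto
      then show "w k = (\<one>\<^bsub>\<Delta>\<^esub> \<oplus>\<^bsub>\<Delta>\<^esub> P \<otimes>\<^bsub>\<Delta>\<^esub> (single_term (- (\<pi> ^ (m - 1))) 0 \<otimes>\<^bsub>\<Delta>\<^esub> x)) k"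
        unfolding w_def P using x by (subst minus_coeff) (auto simp: scalar_coeff mult.assoc)
    qed
    then show ?thesis using one_plus_P_Units x by auto
  qed
  then have wc: "w \<in> carrier \<Delta>" "inv\<^bsub>\<Delta>\<^esub> w \<in> carrier \<Delta>" by auto
  have w'c: "w' \<in> carrier \<Delta>" using x \<gamma> by (simp add: w'_def)
  have "u \<otimes>\<^bsub>\<Delta>\<^esub> x = x \<otimes>\<^bsub>\<Delta>\<^esub> u"
    using x N_gt_1 at(1) g_fixes_R by (intro u_commute_fixed) (auto simp: x_def)
  then have "u \<otimes>\<^bsub>\<Delta>\<^esub> (P [^]\<^bsub>\<Delta>\<^esub> m \<otimes>\<^bsub>\<Delta>\<^esub> x) = single_term \<gamma> 0 \<otimes>\<^bsub>\<Delta>\<^esub> x \<otimes>\<^bsub>\<Delta>\<^esub> u"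
    using x u(2) \<gamma> u_commute_scalar[of "\<pi> ^ m"] N_gt_1 unfolding P
    by (metis order.m_assoc scalar_closed power_closed \<open>\<pi> \<in> S\<close>)
  then have "u \<otimes>\<^bsub>\<Delta>\<^esub> w = w' \<otimes>\<^bsub>\<Delta>\<^esub> u"
    using x u \<gamma> unfolding w_def w'_def order.minus_eq
    by (simp add: order.r_distr order.l_distr order.r_minus order.l_minus)
  then have "u \<otimes>\<^bsub>\<Delta>\<^esub> w \<otimes>\<^bsub>\<Delta>\<^esub> inv\<^bsub>\<Delta>\<^esub> u = w'"
    using u w'c by (metis order.m_assoc order.Units_r_inv order.r_one order.Units_inv_closed)
  then have comm: "commutator \<Delta> u w = w' \<otimes>\<^bsub>\<Delta>\<^esub> inv\<^bsub>\<Delta>\<^esub> w"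
    by (simp only: commutator_def)
  \<comment> \<open>P is pulled to the left of y, so that the product of y and w agrees with y up to
    a multiple of P.\<close>
  obtain y' where y': "y' \<in> carrier \<Delta>" "y \<otimes>\<^bsub>\<Delta>\<^esub> P = P \<otimes>\<^bsub>\<Delta>\<^esub> y'" using P_normal[OF y] .
  define v where "v = y' \<otimes>\<^bsub>\<Delta>\<^esub> (single_term (\<pi> ^ (m - 1)) 0 \<otimes>\<^bsub>\<Delta>\<^esub> x)"
  have v: "v \<in> carrier \<Delta>" using y' x by (simp add: v_def)
  have "P [^]\<^bsub>\<Delta>\<^esub> m = P \<otimes>\<^bsub>\<Delta>\<^esub> single_term (\<pi> ^ (m - 1)) 0"
    unfolding P using m(1) by (subst scalar_scalar_mult) (auto simp flip: power_Suc)
  then have "y \<otimes>\<^bsub>\<Delta>\<^esub> (P [^]\<^bsub>\<Delta>\<^esub> m \<otimes>\<^bsub>\<Delta>\<^esub> x)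
      = (y \<otimes>\<^bsub>\<Delta>\<^esub> P) \<otimes>\<^bsub>\<Delta>\<^esub> (single_term (\<pi> ^ (m - 1)) 0 \<otimes>\<^bsub>\<Delta>\<^esub> x)"
    using y x by (simp add: order.m_assoc)
  also have "\<dots> = P \<otimes>\<^bsub>\<Delta>\<^esub> v" using y' x by (simp add: v_def order.m_assoc)
  finally have "y \<otimes>\<^bsub>\<Delta>\<^esub> w = y \<ominus>\<^bsub>\<Delta>\<^esub> P \<otimes>\<^bsub>\<Delta>\<^esub> v"
    using y x unfolding w_def P order.minus_eq by (simp add: order.r_distr order.r_minus)
  then have yw: "(y \<otimes>\<^bsub>\<Delta>\<^esub> w) k = y k - \<pi> * v k" for k
    using y v by (simp add: minus_coeff scalar_coeff)
  have dc: "d \<in> carrier \<Delta>" unfolding d P using y by simp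
  have "d \<otimes>\<^bsub>\<Delta>\<^esub> w = w \<oplus>\<^bsub>\<Delta>\<^esub> P [^]\<^bsub>\<Delta>\<^esub> n \<otimes>\<^bsub>\<Delta>\<^esub> (y \<otimes>\<^bsub>\<Delta>\<^esub> w)"
    unfolding d P using y wc by (simp add: order.l_distr order.m_assoc)
  then have dw: "(d \<otimes>\<^bsub>\<Delta>\<^esub> w) k = w k + \<pi> ^ n * (y k - \<pi> * v k)" for k
    unfolding P using y wc yw by (simp add: scalar_coeff)
  have wk: "w k = \<one>\<^bsub>\<Delta>\<^esub> k - \<pi> ^ m * x k" "w' k = \<one>\<^bsub>\<Delta>\<^esub> k - \<gamma> * x k" for k
    unfolding w_def w'_def P using x \<gamma> by (simp_all add: minus_coeff scalar_coeff del: one_coeff)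
  \<comment> \<open>After division by \<open>\<pi> ^ (n + 1)\<close> three contributions remain: q
    from the residue equation, \<open>e * x\<close> from the conjugate of \<open>\<pi> ^ m\<close>,
    and v from the product of y and w.\<close>
  define b where "b = (\<lambda>k. q k + e * x k - v k)"
  have b: "b \<in> carrier \<Delta>" using q x v e by (auto simp: b_def carrier_iff)
  have eq: "d \<otimes>\<^bsub>\<Delta>\<^esub> w \<ominus>\<^bsub>\<Delta>\<^esub> w' = P [^]\<^bsub>\<Delta>\<^esub> (n + 1) \<otimes>\<^bsub>\<Delta>\<^esub> b"
  proof
    fix k
    have "(d \<otimes>\<^bsub>\<Delta>\<^esub> w \<ominus>\<^bsub>\<Delta>\<^esub> w') k = (\<gamma> - \<pi> ^ m) * x k + \<pi> ^ n * (y k - \<pi> * v k)"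
      using dc wc w'c by (simp add: minus_coeff dw wk algebra_simps del: one_coeff)
    also have "\<gamma> - \<pi> ^ m = \<pi> ^ n * (of_nat m + \<pi> * e)" using e by (simp add: \<gamma>_def)
    also have "\<dots> * x k + \<pi> ^ n * (y k - \<pi> * v k)
        = \<pi> ^ n * ((y k + of_nat m * x k) + \<pi> * (e * x k - v k))"
      by (simp add: algebra_simps)
    also have "\<dots> = \<pi> ^ (n + 1) * b k" unfolding yx by (simp add: b_def algebra_simps)
    finally show "(d \<otimes>\<^bsub>\<Delta>\<^esub> w \<ominus>\<^bsub>\<Delta>\<^esub> w') k = (P [^]\<^bsub>\<Delta>\<^esub> (n + 1) \<otimes>\<^bsub>\<Delta>\<^esub> b) k"
      unfolding P using b by (simp add: scalar_coeff)
  qed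
  have "d \<ominus>\<^bsub>\<Delta>\<^esub> commutator \<Delta> u w = (d \<otimes>\<^bsub>\<Delta>\<^esub> w \<ominus>\<^bsub>\<Delta>\<^esub> w') \<otimes>\<^bsub>\<Delta>\<^esub> inv\<^bsub>\<Delta>\<^esub> w"
    using dc w wc w'c unfolding comm order.minus_eq
    by (simp add: order.l_distr order.l_minus order.m_assoc)
  also have "\<dots> = P [^]\<^bsub>\<Delta>\<^esub> (n + 1) \<otimes>\<^bsub>\<Delta>\<^esub> (b \<otimes>\<^bsub>\<Delta>\<^esub> inv\<^bsub>\<Delta>\<^esub> w)"
    unfolding eq P using b wc by (intro order.m_assoc) auto
  finally have "d \<ominus>\<^bsub>\<Delta>\<^esub> commutator \<Delta> u w \<in> (P [^]\<^bsub>\<Delta>\<^esub> (n + 1)) <#\<^bsub>\<Delta>\<^esub> carrier \<Delta>"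
    using b wc unfolding l_coset_def by blast
  then show ?thesis using x w unfolding w_def by blast
qed

end

section \<open>Adjoining a root of unity\<close>

context unital_subring
begin

lemma poly_closed: "(\<And>i. Polynomial.coeff f i \<in> S) \<Longrightarrow> x \<in> S \<Longrightarrow> poly f x \<in> S"
  by (auto simp: poly_altdef)

end

lemma unital_subring_adjoin:
  assumes "unital_subring R"
  shows "unital_subring (adjoin R z)"
proof -
  interpret unital_subring R by fact
  show ?thesis
  proof
    have "1 = poly [:1:] z" "\<And>i. Polynomial.coeff [:1:] i \<in> R"
      by (auto simp: coeff_pCons split: nat.split)
    then show "1 \<in> adjoin R z" unfolding adjoin_def by blast
    fix a b assume "a \<in> adjoin R z" "b \<in> adjoin R z"
    then obtain f h where fh: "a = poly f z" "b = poly h z"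
      "\<And>i. Polynomial.coeff f i \<in> R" "\<And>i. Polynomial.coeff h i \<in> R"
      unfolding adjoin_def by blast
    have "a - b = poly (f - h) z" "\<And>i. Polynomial.coeff (f - h) i \<in> R"
      using fh by auto
    then show "a - b \<in> adjoin R z" unfolding adjoin_def by blast
    have "a * b = poly (f * h) z" "\<And>i. Polynomial.coeff (f * h) i \<in> R"
      using fh by (auto simp: coeff_mult)
    then show "a * b \<in> adjoin R z" unfolding adjoin_def by blast
  qed
qed

lemma subset_adjoin:
  assumes "unital_subring R"
  shows "R \<subseteq> adjoin R z"
proof
  interpret unital_subring R by fact
  fix a assume "a \<in> R"
  then have "a = poly [:a:] z" "\<And>i. Polynomial.coeff [:a:] i \<in> R"
    by (auto simp: coeff_pCons split: nat.split)
  then show "a \<in> adjoin R z" unfolding adjoin_def by blast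
qed

lemma generator_in_adjoin:
  assumes "unital_subring R"
  shows "z \<in> adjoin R z"
proof -
  interpret unital_subring R by fact
  have "z = poly [:0, 1:] z" "\<And>i. Polynomial.coeff [:0, 1:] i \<in> R"
    by (auto simp: coeff_pCons split: nat.split)
  then show ?thesis unfolding adjoin_def by blast
qed

text \<open>Since z is 1 modulo 1 - z, replacing z by 1 in a polynomial changes its value by a
  multiple of 1 - z, and the value at 1 lies in R.\<close>

lemma adjoin_residue:
  assumes "unital_subring R" "b \<in> adjoin R z"
  shows "\<exists>a\<in>R. \<exists>t\<in>adjoin R z. b = a + (1 - z) * t"
proof -
  interpret unital_subring R by fact
  interpret A: unital_subring "adjoin R z" by (rule unital_subring_adjoin) fact
  have sub: "R \<subseteq> adjoin R z" by (rule subset_adjoin) fact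
  have z: "z \<in> adjoin R z" by (rule generator_in_adjoin) fact
  obtain f where f: "b = poly f z" "\<And>i. Polynomial.coeff f i \<in> R"
    using assms(2) unfolding adjoin_def by blast
  have "\<exists>t. t \<in> adjoin R z \<and> z ^ i = 1 + (z - 1) * t" for i
    by (rule A.power_diff_one_dvd[OF z, of i]) blast
  then obtain t where t: "\<And>i. t i \<in> adjoin R z" "\<And>i. z ^ i = 1 + (z - 1) * t i" by metis
  let ?t = "\<Sum>i\<le>Polynomial.degree f. - (Polynomial.coeff f i * t i)"
  have "b = (\<Sum>i\<le>Polynomial.degree f. Polynomial.coeff f i * (1 + (z - 1) * t i))"
    unfolding f(1) poly_altdef by (intro sum.cong refl arg_cong2[where f = "(*)"] t(2))
  also have "\<dots> = (\<Sum>i\<le>Polynomial.degree f. Polynomial.coeff f i + (1 - z) * (- (Polynomial.coeff f i * t i)))"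
    by (intro sum.cong refl) (simp add: algebra_simps)
  also have "\<dots> = poly f 1 + (1 - z) * ?t"
    by (simp only: sum.distrib poly_altdef power_one mult_1_right sum_distrib_left)
  finally have "b = poly f 1 + (1 - z) * ?t" .
  moreover have "?t \<in> adjoin R z"
    using t(1) f(2) sub by (intro A.sum_closed A.uminus_closed A.mult_closed) auto
  moreover have "poly f 1 \<in> R" using f(2) by (intro poly_closed) auto
  ultimately show ?thesis by blast
qed

text \<open>Exponents are reduced modulo q. The coefficients need not be unique; what matters is
  that the same q powers serve all elements of \<open>adjoin R z\<close>.\<close>

lemma adjoin_root_of_unity:
  assumes "unital_subring R" "z ^ q = 1" "0 < q" "b \<in> adjoin R z"
  obtains a where "\<And>i. a i \<in> R" "b = (\<Sum>i<q. a i * z ^ i)"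
proof -
  interpret unital_subring R by fact
  obtain f where f: "b = poly f z" "\<And>i. Polynomial.coeff f i \<in> R"
    using assms(4) unfolding adjoin_def by blast
  have "\<exists>a. (\<forall>i. a i \<in> R) \<and> (\<Sum>j<k. Polynomial.coeff f j * z ^ j) = (\<Sum>i<q. a i * z ^ i)" for k
  proof (induction k)
    case 0
    show ?case by (rule exI[of _ "\<lambda>_. 0"]) simp
  next
    case (Suc k)
    then obtain a where a: "\<And>i. a i \<in> R"
      "(\<Sum>j<k. Polynomial.coeff f j * z ^ j) = (\<Sum>i<q. a i * z ^ i)" by blast
    define a' where "a' = (\<lambda>i. a i + (if i = k mod q then Polynomial.coeff f k else 0))"
    have "z ^ k = z ^ (q * (k div q) + k mod q)" by simp
    also have "\<dots> = z ^ (k mod q)" unfolding power_add power_mult by (simp add: assms(2))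
    finally have zk: "z ^ k = z ^ (k mod q)" .
    have "(\<Sum>i<q. a' i * z ^ i) = (\<Sum>i<q. a i * z ^ i)
        + (\<Sum>i<q. if i = k mod q then Polynomial.coeff f k * z ^ i else 0)"
      by (simp add: a'_def distrib_right sum.distrib if_distrib[of "\<lambda>x. x * _"] cong: if_cong)
    also have "\<dots> = (\<Sum>j<Suc k. Polynomial.coeff f j * z ^ j)"
      using assms(3) by (simp add: a(2) zk)
    finally show ?case using a f(2) by (intro exI[of _ a']) (auto simp: a'_def)
  qed
  then obtain a where "\<forall>i. a i \<in> R"
    "(\<Sum>j<Suc (Polynomial.degree f). Polynomial.coeff f j * z ^ j) = (\<Sum>i<q. a i * z ^ i)" by blast
  then show ?thesis using that[of a] f(1) by (simp add: poly_altdef lessThan_Suc_atMost)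
qed

section \<open>Subrings of a field as algebraic structures, and units congruent to 1 modulo
  p\<close>

lemma ring_on_simps [simp]:
  "carrier (ring_on S) = S" "\<one>\<^bsub>ring_on S\<^esub> = 1" "\<zero>\<^bsub>ring_on S\<^esub> = 0"
  "a \<otimes>\<^bsub>ring_on S\<^esub> b = a * b" "a \<oplus>\<^bsub>ring_on S\<^esub> b = a + b"
  by (simp_all add: ring_on_def ring_of_type_algebra_def)

lemma ring_ring_on:
  assumes "unital_subring S"
  shows "ring (ring_on S)"
proof -
  interpret unital_subring S by fact
  show ?thesis
  proof (rule ringI)
    show "abelian_group (ring_on S)"
    proof (rule abelian_groupI)
      fix x assume "x \<in> carrier (ring_on S)"
      then show "\<exists>y\<in>carrier (ring_on S). y \<oplus>\<^bsub>ring_on S\<^esub> x = \<zero>\<^bsub>ring_on S\<^esub>"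
        by (intro bexI[of _ "- x"]) auto
    qed auto
  qed (auto simp: algebra_simps intro!: monoidI)
qed

lemma unital_subring_of_ring_on:
  assumes "ring (ring_on S)"
  shows "unital_subring S"
proof -
  interpret ring "ring_on S" by fact
  show ?thesis
  proof
    show "1 \<in> S" using one_closed by simp
    show "a * b \<in> S" if "a \<in> S" "b \<in> S" for a b using m_closed[of a b] that by simp
    show "a - b \<in> S" if ab: "a \<in> S" "b \<in> S" for a b
    proof -
      have "\<ominus>\<^bsub>ring_on S\<^esub> b + b = 0" using l_neg[of b] ab by simp
      then have "\<ominus>\<^bsub>ring_on S\<^esub> b = - b" by (simp add: eq_neg_iff_add_eq_0)
      moreover have "\<ominus>\<^bsub>ring_on S\<^esub> b \<in> S" using a_inv_closed[of b] ab by simp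
      ultimately show ?thesis using a_closed[of a "- b"] ab by simp
    qed
  qed
qed

text \<open>Nakayama in the commutative ring R[z], with the generators z^i for i < q and with c =
  p.\<close>

lemma adjoin_unit_mod:
  fixes R :: "'a :: field set"
  assumes R: "unital_subring R" and z: "z ^ q = 1" "0 < q"
    and unit: "\<And>a. a \<in> R \<Longrightarrow> \<exists>b\<in>R. (1 + of_nat p * a) * b = 1"
    and a: "a \<in> adjoin R z"
  shows "\<exists>b\<in>adjoin R z. (1 + of_nat p * a) * b = 1"
proof -
  interpret unital_subring R by fact
  interpret A: unital_subring "adjoin R z" by (rule unital_subring_adjoin) fact
  interpret ring "ring_on (adjoin R z)" by (rule ring_ring_on) unfold_locales
  have sub: "R \<subseteq> adjoin R z" by (rule subset_adjoin) fact
  have zA: "z \<in> adjoin R z" by (rule generator_in_adjoin) fact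
  have neg: "\<ominus>\<^bsub>ring_on (adjoin R z)\<^esub> b = - b" if "b \<in> adjoin R z" for b
    using that by (intro minus_equality) auto
  have "subring R (ring_on (adjoin R z))"
    using sub neg by (intro subringI) (auto simp: subset_iff)
  moreover have "b \<in> left_span (ring_on (adjoin R z)) R (\<lambda>i. z ^ i) q" if b: "b \<in> adjoin R z" for b
  proof -
    obtain c where c: "\<And>i. c i \<in> R" "b = (\<Sum>i<q. c i * z ^ i)"
      using adjoin_root_of_unity[OF R z b] by blast
    have "(\<Sum>i<k. c i * z ^ i) \<in> left_span (ring_on (adjoin R z)) R (\<lambda>i. z ^ i) k" for k
      by (induction k) (use c(1) in auto)
    then show ?thesis by (simp only: c(2))
  qed
  ultimately have "\<one>\<^bsub>ring_on (adjoin R z)\<^esub> \<oplus>\<^bsub>ring_on (adjoin R z)\<^esub>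
      of_nat p \<otimes>\<^bsub>ring_on (adjoin R z)\<^esub> a \<in> Units (ring_on (adjoin R z))"
    using unit a zA
    by (intro one_plus_normal_Units[of R "of_nat p" q "\<lambda>i. z ^ i"])
       (auto simp: mult.commute)
  then show ?thesis unfolding Units_def by auto
qed

section \<open>Power series over subrings of a field\<close>

lemma unital_subring_power_series:
  assumes "unital_subring R"
  shows "unital_subring (power_series_over R)"
proof -
  interpret unital_subring R by fact
  show ?thesis by unfold_locales (auto simp: power_series_over_def fps_mult_nth)
qed

text \<open>The inverse exists over the ambient field. Comparing coefficients in f f^(-1) = 1 and
  multiplying by b expresses its n-th coefficient through earlier ones, all in R.\<close>

lemma power_series_unit:
  fixes f :: "'a :: field fps"
  assumes "unital_subring R" and f: "f \<in> power_series_over R" and b: "b \<in> R" "fps_nth f 0 * b = 1"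
  shows "inverse f \<in> power_series_over R" "f * inverse f = 1"
proof -
  interpret unital_subring R by fact
  have f0: "fps_nth f 0 \<noteq> 0" using b by auto
  show inv: "f * inverse f = 1"
    using inverse_mult_eq_1[OF f0] by (simp add: mult.commute)
  have "fps_nth (inverse f) n \<in> R" for n
  proof (induction n rule: less_induct)
    case (less n)
    show ?case
    proof (cases "n = 0")
      case True
      then show ?thesis using b f0 by (simp add: inverse_unique)
    next
      case False
      have "0 = fps_nth (f * inverse f) n" using False by (simp add: inv)
      also have "\<dots> = (\<Sum>i=0..n. fps_nth f i * fps_nth (inverse f) (n - i))"
        by (rule fps_mult_nth)
      also have "\<dots> = fps_nth f 0 * fps_nth (inverse f) n
          + (\<Sum>i=Suc 0..n. fps_nth f i * fps_nth (inverse f) (n - i))"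
        by (subst sum.atLeast_Suc_atMost) auto
      finally have eq: "fps_nth f 0 * fps_nth (inverse f) n
          = - (\<Sum>i=Suc 0..n. fps_nth f i * fps_nth (inverse f) (n - i))"
        by (simp add: eq_neg_iff_add_eq_0)
      have "fps_nth (inverse f) n = (fps_nth f 0 * b) * fps_nth (inverse f) n" by (simp add: b(2))
      also have "\<dots> = b * (fps_nth f 0 * fps_nth (inverse f) n)" by (simp only: mult_ac)
      also have "\<dots> = b * - (\<Sum>i=Suc 0..n. fps_nth f i * fps_nth (inverse f) (n - i))"
        unfolding eq ..
      also have "\<dots> \<in> R"
        using b(1) f less by (intro mult_closed uminus_closed sum_closed) (auto simp: power_series_over_def)
      finally show ?thesis .
    qed
  qed
  then show "inverse f \<in> power_series_over R" by (simp add: power_series_over_def)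
qed

lemma unital_subring_to_fract:
  assumes "unital_subring R"
  shows "unital_subring (to_fract ` R)"
proof -
  interpret unital_subring R by fact
  show ?thesis
    by unfold_locales (auto simp flip: to_fract_1 to_fract_diff to_fract_mult)
qed

lemma to_fract_of_nat [simp]: "to_fract (of_nat k) = of_nat k"
  by (induction k) auto

lemma to_fract_power [simp]: "to_fract (a ^ k) = to_fract a ^ k"
  by (induction k) auto

text \<open>All coefficients of a series over R[z] are combinations of the same q powers of z, so
  for each i < q the coefficients of z^i can be collected into one series over R. Hence adjoining z
  commutes with forming power series.\<close>

lemma power_series_over_adjoin:
  fixes R :: "'a :: field set"
  assumes R: "unital_subring R" and z: "z ^ q = 1" "0 < q"
  shows "to_fract ` power_series_over (adjoin R z)
    = adjoin (to_fract ` power_series_over R) (to_fract (fps_const z))" (is "?B = adjoin ?R ?z")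
proof
  interpret unital_subring R by fact
  interpret R': unital_subring ?R
    by (intro unital_subring_to_fract unital_subring_power_series) fact
  interpret B: unital_subring ?B
    by (intro unital_subring_to_fract unital_subring_power_series unital_subring_adjoin) fact
  have sub: "R \<subseteq> adjoin R z" by (rule subset_adjoin) fact
  have zA: "z \<in> adjoin R z" by (rule generator_in_adjoin) fact
  interpret A: unital_subring "adjoin R z" by (rule unital_subring_adjoin) fact
  have zB: "?z \<in> ?B"
    using zA by (auto simp: power_series_over_def)
  show "adjoin ?R ?z \<subseteq> ?B"
  proof
    fix b assume "b \<in> adjoin ?R ?z"
    then obtain f where f: "b = poly f ?z" "\<And>i. Polynomial.coeff f i \<in> ?R"
      unfolding adjoin_def by blast
    have "?R \<subseteq> ?B" using sub by (auto simp: power_series_over_def)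
    then show "b \<in> ?B" unfolding f(1) using f(2) zB by (intro B.poly_closed) auto
  qed
  interpret A': unital_subring "adjoin ?R ?z"
    by (rule unital_subring_adjoin) unfold_locales
  have zA': "?z \<in> adjoin ?R ?z" and subA': "?R \<subseteq> adjoin ?R ?z"
    using generator_in_adjoin[of ?R ?z] subset_adjoin[of ?R ?z] R'.unital_subring_axioms by auto
  show "?B \<subseteq> adjoin ?R ?z"
  proof
    fix b assume "b \<in> ?B"
    then obtain f where f: "b = to_fract f" "\<And>n. fps_nth f n \<in> adjoin R z"
      by (auto simp: power_series_over_def)
    have "\<exists>a. (\<forall>i. a i \<in> R) \<and> fps_nth f n = (\<Sum>i<q. a i * z ^ i)" for n
      by (rule adjoin_root_of_unity[OF R z f(2)[of n]]) blast
    then obtain a where a: "\<And>n i. a n i \<in> R" "\<And>n. fps_nth f n = (\<Sum>i<q. a n i * z ^ i)"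
      by metis
    have "f = (\<Sum>i<q. Abs_fps (\<lambda>n. a n i) * fps_const z ^ i)"
      by (rule fps_ext) (simp add: a(2) fps_sum_nth fps_const_power)
    then have "b = (\<Sum>i<q. to_fract (Abs_fps (\<lambda>n. a n i)) * ?z ^ i)"
      unfolding f(1) by (simp only: to_fract_sum to_fract_mult to_fract_power)
    also have "\<dots> \<in> adjoin ?R ?z"
      using a(1) zA' subA'
      by (intro A'.sum_closed A'.mult_closed A'.power_closed) (auto simp: power_series_over_def)
    finally show "b \<in> adjoin ?R ?z" .
  qed
qed

section \<open>Integers of an unramified extension\<close>

text \<open>Allows a p-adic integer to be given by any integer sequence whose successive terms agree
  modulo p^k. Ring operations are then computed termwise in the integers and reduced at the
  end.\<close>

definition padic_of :: "nat \<Rightarrow> (nat \<Rightarrow> int) \<Rightarrow> nat \<Rightarrow> int" where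
  "padic_of p f = (\<lambda>k. f k mod int p ^ k)"

lemma padic_of_closed:
  assumes "0 < p" "\<And>k. int p ^ k dvd f (Suc k) - f k"
  shows "padic_of p f \<in> carrier (padic_ints p)"
proof -
  have "f (Suc k) mod int p ^ Suc k mod int p ^ k = f k mod int p ^ k" for k
  proof -
    have "f (Suc k) mod int p ^ Suc k mod int p ^ k = f (Suc k) mod int p ^ k"
      by (rule mod_mod_cancel) simp
    also have "\<dots> = f k mod int p ^ k" using assms(2)[of k] by (simp add: mod_eq_dvd_iff)
    finally show ?thesis .
  qed
  then show ?thesis using assms(1) by (simp add: padic_ints_def padic_of_def)
qed

lemma padic_dvd:
  assumes "a \<in> carrier (padic_ints p)"
  shows "int p ^ k dvd a (Suc k) - a k"
proof -
  have "a (Suc k) mod int p ^ k = a k" "a k \<in> {0..<int p ^ k}" using assms by (auto simp: padic_ints_def)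
  then have "a (Suc k) mod int p ^ k = a k mod int p ^ k" by simp
  then show ?thesis by (simp add: mod_eq_dvd_iff)
qed

lemma padic_of_id: "a \<in> carrier (padic_ints p) \<Longrightarrow> padic_of p a = a"
  by (auto simp: padic_ints_def padic_of_def)

lemma padic_ops:
  "\<one>\<^bsub>padic_ints p\<^esub> = padic_of p (\<lambda>_. 1)"
  "padic_of p f \<otimes>\<^bsub>padic_ints p\<^esub> padic_of p h = padic_of p (\<lambda>k. f k * h k)"
  "padic_of p f \<oplus>\<^bsub>padic_ints p\<^esub> padic_of p h = padic_of p (\<lambda>k. f k + h k)"
  by (auto simp: padic_ints_def padic_of_def mod_mult_eq mod_add_eq)

lemma padic_mult_dvd:
  assumes "a \<in> carrier (padic_ints p)" "b \<in> carrier (padic_ints p)"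
  shows "int p ^ k dvd a (Suc k) * b (Suc k) - a k * b k"
proof -
  have "a (Suc k) * b (Suc k) - a k * b k
      = (a (Suc k) - a k) * b (Suc k) + a k * (b (Suc k) - b k)"
    by (simp add: algebra_simps)
  then show ?thesis using padic_dvd[OF assms(1), of k] padic_dvd[OF assms(2), of k] by simp
qed

text \<open>The inverse is given modulo \<open>p ^ k\<close> by the geometric series truncated after \<open>k\<close> terms.\<close>

lemma padic_unit:
  assumes p: "0 < p" and a: "a \<in> carrier (padic_ints p)"
  obtains b where "b \<in> carrier (padic_ints p)"
    "padic_of p (\<lambda>k. 1 + int p * a k) \<otimes>\<^bsub>padic_ints p\<^esub> b = \<one>\<^bsub>padic_ints p\<^esub>"
proof -
  define x where "x k = - (int p * a k)" for k
  define f where "f k = (\<Sum>i<k. x k ^ i)" for k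
  have "int p ^ k dvd f (Suc k) - f k" for k
  proof -
    have "x (Suc k) - x k = - int p * (a (Suc k) - a k)" by (simp add: x_def algebra_simps)
    then have "int p ^ k dvd x (Suc k) - x k" using padic_dvd[OF a, of k] by simp
    then have "int p ^ k dvd (\<Sum>i<k. x (Suc k) ^ i - x k ^ i)"
      by (intro dvd_sum) (metis dvd_trans dvd_triv_left power_diff_sumr2)
    moreover have "int p ^ k dvd x (Suc k) ^ k"
      unfolding x_def by (intro dvd_power_same) simp
    moreover have "f (Suc k) - f k = (\<Sum>i<k. x (Suc k) ^ i - x k ^ i) + x (Suc k) ^ k"
      by (simp add: f_def sum_subtractf)
    ultimately show ?thesis by simp
  qed
  then have "padic_of p f \<in> carrier (padic_ints p)" using p by (intro padic_of_closed)
  moreover have "padic_of p (\<lambda>k. (1 + int p * a k) * f k) = padic_of p (\<lambda>_. 1)"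
  proof
    fix k
    have "(1 + int p * a k) * f k = 1 - x k ^ k"
      unfolding f_def using power_diff_1_eq[of "x k" k] by (simp add: x_def algebra_simps)
    moreover have "int p ^ k dvd x k ^ k"
      unfolding x_def by (intro dvd_power_same) simp
    ultimately show "padic_of p (\<lambda>k. (1 + int p * a k) * f k) k = padic_of p (\<lambda>_. 1) k"
      by (simp add: padic_of_def mod_eq_dvd_iff)
  qed
  ultimately show ?thesis using that by (simp add: padic_ops)
qed

lemma padic_image:
  fixes \<iota> :: "(nat \<Rightarrow> int) \<Rightarrow> 'a :: field"
  assumes p: "0 < p" and hom: "\<iota> \<in> ring_hom (padic_ints p) ring_of_type_algebra"
  shows "unital_subring (\<iota> ` carrier (padic_ints p))"
    and "a \<in> \<iota> ` carrier (padic_ints p) \<Longrightarrow> \<exists>b\<in>\<iota> ` carrier (padic_ints p). (1 + of_nat p * a) * b = 1"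
proof -
  let ?Z = "padic_ints p"
  have one: "\<iota> \<one>\<^bsub>?Z\<^esub> = 1"
    using ring_hom_one[OF hom] by (simp add: ring_of_type_algebra_def)
  have mult: "\<iota> (a \<otimes>\<^bsub>?Z\<^esub> b) = \<iota> a * \<iota> b" and add: "\<iota> (a \<oplus>\<^bsub>?Z\<^esub> b) = \<iota> a + \<iota> b"
    if "a \<in> carrier ?Z" "b \<in> carrier ?Z" for a b
    using ring_hom_mult[OF hom that] ring_hom_add[OF hom that] by (simp_all add: ring_of_type_algebra_def)
  show sub: "unital_subring (\<iota> ` carrier ?Z)"
  proof
    have "\<one>\<^bsub>?Z\<^esub> \<in> carrier ?Z" unfolding padic_ops using p by (intro padic_of_closed) auto
    then show "1 \<in> \<iota> ` carrier ?Z" using one by force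
    fix x y assume "x \<in> \<iota> ` carrier ?Z" "y \<in> \<iota> ` carrier ?Z"
    then obtain a b where ab: "a \<in> carrier ?Z" "b \<in> carrier ?Z" "x = \<iota> a" "y = \<iota> b" by blast
    have "a \<otimes>\<^bsub>?Z\<^esub> b = padic_of p (\<lambda>k. a k * b k)"
      using ab padic_ops(2)[of p a b] by (simp add: padic_of_id)
    also have "\<dots> \<in> carrier ?Z" using p padic_mult_dvd ab by (intro padic_of_closed)
    finally show "x * y \<in> \<iota> ` carrier ?Z" using mult[OF ab(1,2)] ab by (metis imageI)
    define d where "d = padic_of p (\<lambda>k. a k - b k)"
    have d: "d \<in> carrier ?Z" unfolding d_def
    proof (rule padic_of_closed[OF p])
      fix k
      have eq: "a (Suc k) - b (Suc k) - (a k - b k) = (a (Suc k) - a k) - (b (Suc k) - b k)" by simp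
      show "int p ^ k dvd a (Suc k) - b (Suc k) - (a k - b k)"
        unfolding eq by (intro dvd_diff padic_dvd ab)
    qed
    have "d \<oplus>\<^bsub>?Z\<^esub> b = a"
      using ab padic_ops(3)[of p "\<lambda>k. a k - b k" b] by (simp add: padic_of_id d_def)
    then have "x - y = \<iota> d" using add[OF d ab(2)] ab by auto
    then show "x - y \<in> \<iota> ` carrier ?Z" using d by blast
  qed
  assume "a \<in> \<iota> ` carrier ?Z"
  then obtain b where b: "b \<in> carrier ?Z" "a = \<iota> b" by blast
  \<comment> \<open>Induction on j carries the integer multiple j b to \<open>of_nat j * a\<close>
    by additivity of \<open>\<iota>\<close>; the case j = p is the one wanted.\<close>
  have e: "padic_of p (\<lambda>k. 1 + int j * b k) \<in> carrier ?Z
      \<and> \<iota> (padic_of p (\<lambda>k. 1 + int j * b k)) = 1 + of_nat j * a" for j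
  proof (induction j)
    case 0
    have "padic_of p (\<lambda>_. 1) \<in> carrier ?Z" using p by (intro padic_of_closed) auto
    then show ?case using one by (simp add: padic_ops)
  next
    case (Suc j)
    have eq: "padic_of p (\<lambda>k. 1 + int (Suc j) * b k) = padic_of p (\<lambda>k. 1 + int j * b k) \<oplus>\<^bsub>?Z\<^esub> b"
      using padic_ops(3)[of p "\<lambda>k. 1 + int j * b k" b] b by (simp add: padic_of_id algebra_simps)
    have "padic_of p (\<lambda>k. 1 + int (Suc j) * b k) \<in> carrier ?Z"
    proof (rule padic_of_closed[OF p])
      fix k
      have "1 + int (Suc j) * b (Suc k) - (1 + int (Suc j) * b k) = int (Suc j) * (b (Suc k) - b k)"
        by (simp only: right_diff_distrib)
      then show "int p ^ k dvd 1 + int (Suc j) * b (Suc k) - (1 + int (Suc j) * b k)"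
        using padic_dvd[OF b(1), of k] by simp
    qed
    moreover have "\<iota> (padic_of p (\<lambda>k. 1 + int (Suc j) * b k)) = 1 + of_nat (Suc j) * a"
      unfolding eq using add[OF conjunct1[OF Suc] b(1)] Suc b by (simp add: algebra_simps)
    ultimately show ?case by blast
  qed
  obtain b' where b': "b' \<in> carrier ?Z" "padic_of p (\<lambda>k. 1 + int p * b k) \<otimes>\<^bsub>?Z\<^esub> b' = \<one>\<^bsub>?Z\<^esub>"
    using padic_unit[OF p b(1)] .
  then have "(1 + of_nat p * a) * \<iota> b' = 1"
    using mult[OF conjunct1[OF e[of p]] b'(1)] e[of p] one by simp
  then show "\<exists>b\<in>\<iota> ` carrier ?Z. (1 + of_nat p * a) * b = 1" using b' by blast
qed

text \<open>
  From \<open>f y = 0\<close> with \<open>f = \<Sum> a\<^sub>i X\<^sup>i\<close> monic of degree \<open>n\<close> one gets \<open>\<Sum> a\<^sub>i p\<^bsup>n-i\<^esup> (p y)\<^sup>i = 0\<close>, so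
  modulo \<open>1 - p y\<close> the element \<open>\<Sum> a\<^sub>i p\<^bsup>n-i\<^esup>\<close> of \<open>1 + p R\<close> vanishes.
\<close>

lemma integral_closure_unit_mod:
  fixes R :: "'a :: field set"
  assumes R: "unital_subring R" "R \<subseteq> I"
    and I: "I = integral_closure R F" "unital_subring I"
    and unit: "\<And>a. a \<in> R \<Longrightarrow> \<exists>b\<in>R. (1 + of_nat p * a) * b = 1"
    and x: "x \<in> I"
  shows "\<exists>b\<in>I. (1 + of_nat p * x) * b = 1"
proof -
  interpret R: unital_subring R by fact
  interpret unital_subring I by fact
  define y where "y = - x"
  have y: "y \<in> I" using x by (simp add: y_def)
  then obtain f where f: "Polynomial.lead_coeff f = 1" "\<And>i. Polynomial.coeff f i \<in> R" "poly f y = 0"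
    unfolding I(1) integral_closure_def by blast
  define n a where "n = Polynomial.degree f" and "a = Polynomial.coeff f"
  have aO: "a i \<in> I" for i using f(2) R(2) by (auto simp: a_def)
  let ?p = "of_nat p :: 'a"
  have py: "?p * y \<in> I" using y by (intro mult_closed of_nat_closed)
  have "\<exists>t. t \<in> I \<and> (?p * y) ^ i = 1 + (?p * y - 1) * t" for i
    by (rule power_diff_one_dvd[OF py, of i]) blast
  then obtain t where t: "\<And>i. t i \<in> I" "\<And>i. (?p * y) ^ i = 1 + (?p * y - 1) * t i" by metis
  have "0 = ?p ^ n * poly f y" using f by simp
  also have "\<dots> = (\<Sum>i\<le>n. a i * ?p ^ (n - i) * (?p * y) ^ i)"
    unfolding poly_altdef sum_distrib_left n_def[symmetric] a_def[symmetric]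
  proof (intro sum.cong refl)
    fix i assume "i \<in> {..n}"
    then have "?p ^ n = ?p ^ (n - i) * ?p ^ i" by (simp flip: power_add)
    then show "?p ^ n * (a i * y ^ i) = a i * ?p ^ (n - i) * (?p * y) ^ i"
      by (simp add: power_mult_distrib)
  qed
  also have "\<dots> = (\<Sum>i\<le>n. a i * ?p ^ (n - i) + (?p * y - 1) * (a i * ?p ^ (n - i) * t i))"
    unfolding t(2) by (intro sum.cong refl) (simp add: algebra_simps)
  also have "\<dots> = (\<Sum>i\<le>n. a i * ?p ^ (n - i)) + (?p * y - 1) * (\<Sum>i\<le>n. a i * ?p ^ (n - i) * t i)"
    by (simp only: sum.distrib sum_distrib_left)
  finally have 1: "(\<Sum>i\<le>n. a i * ?p ^ (n - i)) = (1 + ?p * x) * (\<Sum>i\<le>n. a i * ?p ^ (n - i) * t i)"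
    by (simp add: y_def algebra_simps add_eq_0_iff)
  have "(\<Sum>i\<le>n. a i * ?p ^ (n - i)) = a n + (\<Sum>i<n. a i * ?p ^ (n - i))"
    by (simp add: lessThan_Suc_atMost[symmetric])
  also have "(\<Sum>i<n. a i * ?p ^ (n - i)) = ?p * (\<Sum>i<n. a i * ?p ^ (n - Suc i))"
    unfolding sum_distrib_left
  proof (intro sum.cong refl)
    fix i assume "i \<in> {..<n}"
    then have "n - i = Suc (n - Suc i)" by auto
    then show "a i * ?p ^ (n - i) = ?p * (a i * ?p ^ (n - Suc i))" by simp
  qed
  also have "a n = 1" using f(1) by (simp add: a_def n_def)
  finally have 2: "(\<Sum>i\<le>n. a i * ?p ^ (n - i)) = 1 + ?p * (\<Sum>i<n. a i * ?p ^ (n - Suc i))" .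
  have "(\<Sum>i<n. a i * ?p ^ (n - Suc i)) \<in> R"
    using f(2) unfolding a_def by (intro R.sum_closed R.mult_closed R.power_closed) auto
  then obtain b where b: "b \<in> R" "(1 + ?p * (\<Sum>i<n. a i * ?p ^ (n - Suc i))) * b = 1"
    using unit by blast
  have "(1 + ?p * x) * ((\<Sum>i\<le>n. a i * ?p ^ (n - i) * t i) * b) = 1"
    using b(2) unfolding 2[symmetric] 1 by (simp add: mult.assoc)
  moreover have "(\<Sum>i\<le>n. a i * ?p ^ (n - i) * t i) * b \<in> I"
    using aO t(1) b(1) R(2) by (intro mult_closed sum_closed power_closed) auto
  ultimately show ?thesis by blast
qed

lemma ring_of_integers_unit:
  fixes \<iota> :: "(nat \<Rightarrow> int) \<Rightarrow> 'a :: field"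
  assumes p: "0 < p" and ext: "finite_unramified_extension p \<iota> F"
  shows "unital_subring (ring_of_integers p \<iota> F)"
    and "a \<in> ring_of_integers p \<iota> F \<Longrightarrow> \<exists>b\<in>ring_of_integers p \<iota> F. (1 + of_nat p * a) * b = 1"
proof -
  let ?R = "\<iota> ` carrier (padic_ints p)" and ?O = "ring_of_integers p \<iota> F"
  have hom: "\<iota> \<in> ring_hom (padic_ints p) ring_of_type_algebra"
    and F: "quotients ?R \<subseteq> F"
    and max: "maximalideal (PIdl\<^bsub>ring_on ?O\<^esub> (of_nat p)) (ring_on ?O)"
    using ext by (auto simp: finite_unramified_extension_def)
  \<comment> \<open>A maximal ideal presupposes a ring, so the closure of the integral elements
    under sums and products comes from the hypothesis on p.\<close>
  have "ring (ring_on ?O)" using max by (simp add: maximalideal_def ideal_def)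
  then show O: "unital_subring ?O" by (rule unital_subring_of_ring_on)
  interpret R: unital_subring ?R by (rule padic_image(1)[OF p hom])
  have sub: "?R \<subseteq> ?O"
  proof
    fix x assume x: "x \<in> ?R"
    then have "x / 1 \<in> quotients ?R" unfolding quotients_def using R.one_closed
      by (intro CollectI exI[of _ x] exI[of _ "1 :: 'a"]) auto
    then have "x \<in> F" using F by auto
    moreover have "Polynomial.coeff [:- x, 1:] i \<in> ?R" for i
      using x by (auto simp: coeff_pCons split: nat.split)
    ultimately show "x \<in> ?O"
      unfolding ring_of_integers_def integral_closure_def
      by (intro CollectI conjI exI[of _ "[:- x, 1:]"]) auto
  qed
  show "\<exists>b\<in>?O. (1 + of_nat p * a) * b = 1" if "a \<in> ?O"
    using integral_closure_unit_mod[OF R.unital_subring_axioms sub _ O padic_image(2)[OF p hom] that]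
    by (simp add: ring_of_integers_def)
qed

section \<open>The theorem\<close>

text \<open>Every element of R[z] is a combination of p^(r+s) powers of z with coefficients fixed by
  g, so g is determined by its value z^e at z, where e = 1 + p^r. Its iterate of order p^s is the
  identity since e^(p^s) is 1 modulo p^(r+s).\<close>

lemma cyclotomic_cyclic_order_adjoin:
  fixes R :: "'b :: field set"
  assumes R: "unital_subring R"
    and p: "Factorial_Ring.prime p" "odd p" and rs: "1 \<le> r" "1 \<le> s"
    and z: "z ^ p ^ (r + s) = 1" "z ^ p ^ (r + s - 1) \<noteq> 1"
    and unit: "\<And>a. a \<in> R \<Longrightarrow> \<exists>b\<in>R. (1 + of_nat p * a) * b = 1"
    and g_add: "\<And>a b. a \<in> adjoin R z \<Longrightarrow> b \<in> adjoin R z \<Longrightarrow> g (a + b) = g a + g b"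
    and g_mult: "\<And>a b. a \<in> adjoin R z \<Longrightarrow> b \<in> adjoin R z \<Longrightarrow> g (a * b) = g a * g b"
    and g_R: "\<And>a. a \<in> R \<Longrightarrow> g a = a" and g_z: "g z = z ^ (1 + p ^ r)"
    and c: "c \<in> R" "inverse c \<in> R" "c \<noteq> 0"
  shows "cyclotomic_cyclic_order (adjoin R z) p r s z g c R"
proof -
  interpret R: unital_subring R by fact
  interpret S: unital_subring "adjoin R z" by (rule unital_subring_adjoin) fact
  have sub: "R \<subseteq> adjoin R z" by (rule subset_adjoin) fact
  have zS: "z \<in> adjoin R z" by (rule generator_in_adjoin) fact
  have p0: "0 < p" using p(1) prime_gt_0_nat by blast
  have g_power: "g (a ^ k) = g a ^ k" if "a \<in> adjoin R z" for a k
    by (induction k) (use that g_R in \<open>auto simp: g_mult\<close>)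
  have g_lin: "g (\<Sum>i<k. a i * w ^ i) = (\<Sum>i<k. a i * g w ^ i)"
    if a: "\<And>i. a i \<in> R" and w: "w \<in> adjoin R z" for a w and k :: nat
  proof (induction k)
    case 0
    show ?case using g_R[OF R.zero_closed] by simp
  next
    case (Suc k)
    have aS: "a i \<in> adjoin R z" for i using a sub by blast
    have "g (\<Sum>i<Suc k. a i * w ^ i) = g (\<Sum>i<k. a i * w ^ i) + g (a k * w ^ k)"
      using aS w by (simp add: S.sum_closed g_add)
    also have "g (a k * w ^ k) = a k * g w ^ k"
      using aS w a by (simp add: g_mult g_power g_R)
    finally show ?case using Suc by simp
  qed
  define e where "e = 1 + p ^ r"
  have gz: "g z = z ^ e" unfolding e_def by (rule g_z)
  have g_iter: "(g ^^ k) (\<Sum>i<q. a i * z ^ i) = (\<Sum>i<q. a i * (z ^ (e ^ k)) ^ i)"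
    if "\<And>i. a i \<in> R" for a k and q :: nat
  proof (induction k)
    case (Suc k)
    have "g (z ^ (e ^ k)) = z ^ (e ^ Suc k)"
      using zS by (simp only: g_power gz power_mult[symmetric] power_Suc)
    then show ?case using Suc zS that by (simp add: g_lin)
  qed simp
  have form: "\<exists>a. (\<forall>i. a i \<in> R) \<and> b = (\<Sum>i<p ^ (r + s). a i * z ^ i)" if "b \<in> adjoin R z" for b
    by (rule adjoin_root_of_unity[OF R z(1) _ that]) (use p0 in auto)
  have "int p ^ (r + s) dvd int e ^ p ^ s - 1"
    using rs by (intro power_prime_power_dvd) (auto simp: e_def)
  moreover have "int e ^ p ^ s - 1 = int (e ^ p ^ s - 1)"
    by (simp add: e_def of_nat_diff)
  ultimately have "p ^ (r + s) dvd e ^ p ^ s - 1"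
    by (metis of_nat_dvd_iff of_nat_power)
  then obtain t where t: "e ^ p ^ s - 1 = p ^ (r + s) * t" by (elim dvdE)
  have "1 \<le> e ^ p ^ s" by (simp add: e_def)
  then have e: "e ^ p ^ s = p ^ (r + s) * t + 1" using t by linarith
  have "z ^ (k * t + 1) = (z ^ k) ^ t * z" for k by (simp add: power_add power_mult)
  then have ze: "z ^ (e ^ p ^ s) = z" by (simp only: e z(1) power_one mult_1_left)
  show ?thesis
  proof
    show "\<exists>b\<in>adjoin R z. (1 + of_nat p * a) * b = 1" if "a \<in> adjoin R z" for a
      by (rule adjoin_unit_mod[OF R z(1) _ unit that]) (use p0 in auto)
    show "g a \<in> adjoin R z" if a: "a \<in> adjoin R z" for a
    proof -
      obtain f where f: "\<forall>i. f i \<in> R" "a = (\<Sum>i<p ^ (r + s). f i * z ^ i)"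
        using form[OF a] by blast
      show ?thesis unfolding f(2) using f(1) sub zS
        by (subst g_lin) (auto simp: g_z intro!: S.sum_closed S.mult_closed S.power_closed)
    qed
    show "(g ^^ p ^ s) a = a" if a: "a \<in> adjoin R z" for a
    proof -
      obtain f where f: "\<forall>i. f i \<in> R" "a = (\<Sum>i<p ^ (r + s). f i * z ^ i)"
        using form[OF a] by blast
      show ?thesis unfolding f(2) using f(1) by (subst g_iter) (auto simp: ze)
    qed
    show "\<exists>a\<in>R. \<exists>t\<in>adjoin R z. b = a + (1 - z) * t" if "b \<in> adjoin R z" for b
      by (rule adjoin_residue[OF R that])
  qed (use p rs z zS g_add g_mult g_R g_z c sub p0 R.one_closed in auto)
qed

lemma subset_quotients: "a \<in> R \<Longrightarrow> 1 \<in> R \<Longrightarrow> a \<in> quotients R"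
  unfolding quotients_def by (intro CollectI exI[of _ a] exI[of _ 1]) auto

theorem mainTheorem8:
  fixes p r s m n :: nat
    and \<iota> :: "(nat \<Rightarrow> int) \<Rightarrow> 'a :: field"
    and F \<OO> :: "'a set"
    and \<zeta> :: "nat \<Rightarrow> 'a"
    and A B :: "'a fps set"
    and g :: "'a fps fract \<Rightarrow> 'a fps fract"
    and D \<Delta> :: "(nat \<Rightarrow> 'a fps fract) ring"
    and u P d :: "nat \<Rightarrow> 'a fps fract"
  assumes "Factorial_Ring.prime p" and "odd p" and "r \<ge> 1" and "s \<ge> 1"
    and "finite_unramified_extension p \<iota> F"
    and "\<OO> = ring_of_integers p \<iota> F"
    and "\<And>k. primitive_root_of_unity (p ^ k) (\<zeta> k)"
    and "\<zeta> 0 = 1" and "\<And>k. k \<ge> 1 \<Longrightarrow> \<zeta> k ^ p = \<zeta> (k - 1)"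
    and "A = power_series_over (adjoin \<OO> (\<zeta> r))"
    and "B = power_series_over (adjoin \<OO> (\<zeta> (r + s)))"
    and "g \<in> carrier (galois_group (fraction_field B) (fraction_field A))"
    and "generate (galois_group (fraction_field B) (fraction_field A)) {g}
          = carrier (galois_group (fraction_field B) (fraction_field A))"
    and "g (to_fract (fps_const (\<zeta> (r + s)))) = to_fract (fps_const (\<zeta> (r + s) ^ (1 + p ^ r)))"
    and "D = cyclic_algebra (fraction_field B) g (p ^ s) (to_fract (1 + fps_X))"
    and "\<Delta> = D\<lparr>carrier := {a \<in> carrier D. \<forall>j < p ^ s. a j \<in> to_fract ` B}\<rparr>"
    and "u = single_term 1 1"
    and "P = single_term (to_fract (fps_const (1 - \<zeta> (r + s)))) 0"
    and "d \<in> Units \<Delta>"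
    and "has_level \<Delta> P d n"
    and "has_type p r n 0" and "n = p ^ r + m - 1"
  shows "\<exists>x \<in> carrier \<Delta>.
           \<one>\<^bsub>\<Delta>\<^esub> \<ominus>\<^bsub>\<Delta>\<^esub> P [^]\<^bsub>\<Delta>\<^esub> m \<otimes>\<^bsub>\<Delta>\<^esub> x \<in> Units \<Delta> \<and>
           d \<ominus>\<^bsub>\<Delta>\<^esub> commutator \<Delta> u (\<one>\<^bsub>\<Delta>\<^esub> \<ominus>\<^bsub>\<Delta>\<^esub> P [^]\<^bsub>\<Delta>\<^esub> m \<otimes>\<^bsub>\<Delta>\<^esub> x)
             \<in> (P [^]\<^bsub>\<Delta>\<^esub> (n + 1)) <#\<^bsub>\<Delta>\<^esub> carrier \<Delta>"
proof -
  have p0: "0 < p" using assms(1) prime_gt_0_nat by blast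
  interpret O: unital_subring \<OO>
    unfolding assms(6) by (rule ring_of_integers_unit(1)[OF p0 assms(5)])
  have O_unit: "\<exists>b\<in>\<OO>. (1 + of_nat p * a) * b = 1" if "a \<in> \<OO>" for a
    using ring_of_integers_unit(2)[OF p0 assms(5)] that unfolding assms(6) by blast
  \<comment> \<open>The image of O[[T]] lies in that of A, hence is fixed by g, and still represents
    all residues of B modulo \<open>\<Pi>\<close>.\<close>
  define R where "R = to_fract ` power_series_over \<OO>"
  define z where "z = to_fract (fps_const (\<zeta> (r + s)))"
  define c where "c = to_fract (1 + fps_X :: 'a fps)"
  have R: "unital_subring R"
    unfolding R_def by (intro unital_subring_to_fract unital_subring_power_series O.unital_subring_axioms)
  have zeta: "\<zeta> (r + s) ^ p ^ (r + s) = 1" "\<zeta> (r + s) ^ p ^ (r + s - 1) \<noteq> 1"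
  proof -
    have prim: "primitive_root_of_unity (p ^ (r + s)) (\<zeta> (r + s))" by (rule assms(7))
    then show "\<zeta> (r + s) ^ p ^ (r + s) = 1" by (simp add: primitive_root_of_unity_def)
    have "p ^ (r + s - 1) < p ^ (r + s)"
      using assms(1,3) prime_gt_1_nat by (intro power_strict_increasing) auto
    then show "\<zeta> (r + s) ^ p ^ (r + s - 1) \<noteq> 1"
      using prim p0 by (simp add: primitive_root_of_unity_def)
  qed
  have z_pow: "z ^ k = to_fract (fps_const (\<zeta> (r + s) ^ k))" for k
    by (simp add: z_def fps_const_power flip: to_fract_power)
  have B_eq: "to_fract ` B = adjoin R z"
    unfolding assms(11) R_def z_def
    by (rule power_series_over_adjoin[OF O.unital_subring_axioms zeta(1)]) (use p0 in simp)
  have B_sub: "to_fract ` B \<subseteq> fraction_field B"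
  proof
    fix b assume "b \<in> to_fract ` B"
    moreover have "1 \<in> to_fract ` B"
      unfolding B_eq by (rule unital_subring.one_closed[OF unital_subring_adjoin[OF R]])
    ultimately show "b \<in> fraction_field B" unfolding fraction_field_def by (rule subset_quotients)
  qed
  have R_sub: "R \<subseteq> fraction_field A"
  proof
    fix b assume b: "b \<in> R"
    have "R \<subseteq> to_fract ` A"
      using subset_adjoin[OF O.unital_subring_axioms, of "\<zeta> r"]
      by (auto simp: R_def assms(10) power_series_over_def)
    then have "b \<in> to_fract ` A" "1 \<in> to_fract ` A"
      using b unital_subring.one_closed[OF R] by blast+
    then show "b \<in> fraction_field A" unfolding fraction_field_def by (rule subset_quotients)
  qed
  have g: "g \<in> ring_hom (ring_on (fraction_field B)) (ring_on (fraction_field B))"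
    "\<And>x. x \<in> fraction_field A \<Longrightarrow> g x = x"
    using assms(12) by (auto simp: galois_group_def)
  have "cyclotomic_cyclic_order (adjoin R z) p r s z g c R"
  proof (rule cyclotomic_cyclic_order_adjoin[OF R assms(1-4)])
    show "z ^ p ^ (r + s) = 1" "z ^ p ^ (r + s - 1) \<noteq> 1"
    proof -
      have "z ^ k = 1 \<longleftrightarrow> \<zeta> (r + s) ^ k = 1" for k
      proof -
        have "z ^ k = 1 \<longleftrightarrow> fps_const (\<zeta> (r + s) ^ k) = fps_const 1"
          unfolding z_pow by (simp flip: to_fract_1)
        then show ?thesis by (metis fps_nth_fps_const)
      qed
      then show "z ^ p ^ (r + s) = 1" "z ^ p ^ (r + s - 1) \<noteq> 1" using zeta by blast+
    qed
    show "\<exists>b\<in>R. (1 + of_nat p * a) * b = 1" if a: "a \<in> R" for a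
    proof -
      obtain f where f: "a = to_fract f" "f \<in> power_series_over \<OO>" using a by (auto simp: R_def)
      interpret OT: unital_subring "power_series_over \<OO>"
        by (intro unital_subring_power_series O.unital_subring_axioms)
      \<comment> \<open>The constant term 1 + p f_0 decides invertibility over O[[T]], and it is a
        unit of O.\<close>
      obtain b where b: "b \<in> \<OO>" "(1 + of_nat p * fps_nth f 0) * b = 1"
        using O_unit f(2) by (auto simp: power_series_over_def)
      have nth: "fps_nth (1 + of_nat p * f) 0 * b = 1" using b(2) by simp
      have "1 + of_nat p * f \<in> power_series_over \<OO>" using f(2) by auto
      note inv = power_series_unit[OF O.unital_subring_axioms this b(1) nth]
      have "(1 + of_nat p * a) * to_fract (inverse (1 + of_nat p * f))
          = to_fract ((1 + of_nat p * f) * inverse (1 + of_nat p * f))"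
        by (simp add: f(1))
      also have "\<dots> = 1" unfolding inv(2) by simp
      finally show ?thesis using inv(1) unfolding R_def by blast
    qed
    show "g (a + b) = g a + g b" "g (a * b) = g a * g b"
      if "a \<in> adjoin R z" "b \<in> adjoin R z" for a b
      using ring_hom_add[OF g(1), of a b] ring_hom_mult[OF g(1), of a b] that B_sub
      unfolding B_eq by auto
    show "g a = a" if "a \<in> R" for a using g(2) R_sub that by blast
    show "g z = z ^ (1 + p ^ r)" unfolding z_pow unfolding z_def by (rule assms(14))
    have X: "1 + fps_X \<in> power_series_over \<OO>" by (auto simp: power_series_over_def)
    then show "c \<in> R" unfolding R_def c_def by (rule imageI)
    \<comment> \<open>The constant term 1 makes 1 + T a unit of O[[T]].\<close>
    have "fps_nth (1 + fps_X :: 'a fps) 0 * 1 = 1" by simp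
    note inv = power_series_unit[OF O.unital_subring_axioms X O.one_closed this]
    have "inverse c = to_fract (inverse (1 + fps_X))"
      unfolding c_def
      by (intro inverse_unique) (simp only: to_fract_mult[symmetric] inv(2) to_fract_1)
    then show "inverse c \<in> R" using inv(1) by (simp add: R_def)
    show "c \<noteq> 0" unfolding c_def to_fract_eq_0_iff
      using inv(2) by (metis mult_zero_left zero_neq_one)
  qed
  then interpret X: cyclotomic_cyclic_order "adjoin R z" p r s z g c R .
  \<comment> \<open>The operations agree, and B lies in its fraction field, so only the two
    descriptions of the carrier have to be compared.\<close>
  have Delta: "\<Delta> = X.\<Delta>"
  proof -
    have D: "D = cyclic_algebra (fraction_field B) g (p ^ s) c" unfolding c_def by (rule assms(15))
    have eq: "{a \<in> carrier D. \<forall>j < p ^ s. a j \<in> to_fract ` B}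
        = {a. (\<forall>j<p ^ s. a j \<in> adjoin R z) \<and> (\<forall>j\<ge>p ^ s. a j = 0)}"
      using B_sub unfolding D B_eq by (auto simp: cyclic_algebra_def)
    show ?thesis
      unfolding assms(16) eq X.\<Delta>_def unfolding D
      by (simp only: cyclic_algebra_def partial_object.update_convs)
  qed
  have P: "P = single_term (1 - z) 0"
    unfolding assms(18) z_def by (simp flip: to_fract_1 to_fract_diff fps_const_1_eq_1)
  obtain m' where m': "\<not> p dvd m'" "1 \<le> m'" "n = p ^ (r + 0) + p ^ 0 * m' - 1"
    using assms(21) unfolding has_type_def by blast
  then have "n = p ^ r + m' - 1" by simp
  \<comment> \<open>As p^r is positive, the natural-number subtraction in n = p^r + m - 1 is exact,
    and the m provided by the type is the given one.\<close>
  moreover have "1 \<le> p ^ r" using p0 by simp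
  ultimately have "m' = m" using assms(22) by linarith
  then have m: "\<not> p dvd m" "1 \<le> m" using m'(1,2) by auto
  obtain y where "y \<in> carrier \<Delta>" "d = \<one>\<^bsub>\<Delta>\<^esub> \<oplus>\<^bsub>\<Delta>\<^esub> P [^]\<^bsub>\<Delta>\<^esub> n \<otimes>\<^bsub>\<Delta>\<^esub> y"
    using assms(20) unfolding has_level_def one_plus_def a_l_coset_def l_coset_def by auto
  then show ?thesis
    using X.commutator_approximation[OF _ m(2,1) assms(22)] unfolding Delta P assms(17) by blast
qed

end
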